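(* Let $P(z),q(z)\in\mathbb{C}[z]$, $q\neq 0$, $a,b\in\mathbb{C}$, $a\neq b$, and let $Q(z)=\int q(z)\,dz$. Suppose that $P(a)=P(b)=c_1$ and that for any critical value $c$ of $P$, except possibly $c_1$, the preimage $P^{-1}(c)$ contains only one critical point of $P$. Then the following two conditions are equivalent: (i) $\int_a^b P^i(z)q(z)\,dz=0$ for all integers $i\ge 0$; (ii) there exist polynomials $\tilde P,\tilde Q,W\in\mathbb{C}[z]$ such that $P(z)=\tilde P(W(z))$, $Q(z)=\tilde Q(W(z))$ and $W(a)=W(b)$.
   Context: $Q$ denotes any antiderivative of $q$ (condition (ii) does not depend on the choice of constant). Critical points and values are the finite ones. *)

theory Defs
  imports
    "HOL-Complex_Analysis.Complex_Analysis"
    "HOL-Computational_Algebra.Computational_Algebra"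
begin

definition critical_point :: "complex poly \<Rightarrow> complex \<Rightarrow> bool" where
  "critical_point P z \<longleftrightarrow> poly (pderiv P) z = 0"

definition critical_value :: "complex poly \<Rightarrow> complex \<Rightarrow> bool" where
  "critical_value P c \<longleftrightarrow> (\<exists>z. critical_point P z \<and> poly P z = c)"

end

theory Submission
  imports Defs "HOL-Computational_Algebra.Field_as_Ring"
begin

text \<open>Suppose the moments vanish and \<open>a \<noteq> b\<close>. For a generic centre \<open>c'\<close> close to \<open>c\<^sub>1\<close>, let \<open>M\<close> be the
  mountain pass level at which \<open>a\<close> and \<open>b\<close> become connected in \<open>{\<bar>P - c'\<bar> < r}\<close>. Both components at level
  \<open>M\<close> touch a critical point \<open>v\<close>, the same one by the hypothesis on critical values, and a path from \<open>a\<close>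
  to \<open>b\<close> can be chosen to cross the level \<open>M\<close> only at \<open>v\<close>, between two different sectors. All other
  contributions to the \<open>k\<close>-th moment of \<open>P - c'\<close> are exponentially smaller than \<open>M ^ k\<close>, so the
  asymptotics at \<open>v\<close> force the branches of \<open>Q\<close> over the two sectors to coincide. Hence infinitely many
  pairs of distinct points are identified by both \<open>P\<close> and \<open>Q\<close>, so by Lueroth's theorem \<open>P\<close> and \<open>Q\<close> have a
  common right factor of degree at least 2. Dividing it out preserves all hypotheses, and induction
  on the degree of \<open>P\<close> ends with \<open>W(a) = W(b)\<close>.\<close>

subsection \<open>Common right composition factors\<close>

lemma degree_diff_eq_left:
  fixes p q :: "'a::ab_group_add poly"
  shows "degree q < degree p \<Longrightarrow> degree (p - q) = degree p"
  using degree_add_eq_left[of "- q" p] by simp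

lemma pderiv_surj: "\<exists>G. pderiv G = (p :: 'a::field_char_0 poly)"
proof
  define G where "G = (\<Sum>i\<le>degree p. monom (coeff p i / of_nat (Suc i)) (Suc i))"
  show "pderiv G = p"
  proof (rule poly_eqI)
    fix n
    have "coeff G (Suc n) = (\<Sum>i\<le>degree p. if i = n then coeff p n / of_nat (Suc n) else 0)"
      unfolding G_def coeff_sum by (intro sum.cong) auto
    then have "coeff G (Suc n) = coeff p n / of_nat (Suc n)"
      by (simp add: coeff_eq_0 del: of_nat_Suc)
    then show "coeff (pderiv G) n = coeff p n" by (simp add: coeff_pderiv del: of_nat_Suc)
  qed
qed

lemma pcompose_power: "(p ^ k) \<circ>\<^sub>p q = (p \<circ>\<^sub>p q) ^ k" for p q :: "'a::comm_ring_1 poly"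
  by (induction k) (simp_all add: pcompose_mult pcompose_1)

lemma pcompose_linear: "[:- c, 1:] \<circ>\<^sub>p W = W - [:c::'a::comm_ring_1:]"
  by (auto simp: poly_eq_iff pcompose_pCons coeff_pCons split: nat.split)

text \<open>Expansion in powers of \<open>W\<close>: dividing \<open>P - P(z0)\<close> by
  \<open>W - W(z0)\<close> leaves a quotient \<open>P1\<close> of smaller degree that inherits the
  divisibility at all but finitely many points of \<open>Z\<close>. Since \<open>Z\<close> is
  infinite, the recursion never runs out of points.\<close>

lemma pcompose_if_dvd_diffs:
  fixes P W :: "'a::{field_char_0} poly"
  assumes "infinite Z" and "degree W > 0"
    and "\<And>z. z \<in> Z \<Longrightarrow> (W - [:poly W z:]) dvd (P - [:poly P z:])"
  shows "\<exists>P'. P = P' \<circ>\<^sub>p W"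
  using assms
proof (induction "degree P" arbitrary: P Z rule: less_induct)
  case less
  show ?case
  proof (cases "degree P = 0")
    case True
    then obtain c where "P = [:c:]" by (metis degree_eq_zeroE)
    then have "P = [:c:] \<circ>\<^sub>p W" by simp
    then show ?thesis by blast
  next
    case False
    obtain z0 where z0: "z0 \<in> Z" using less.prems(1) by (metis finite.emptyI ex_in_conv)
    let ?u = "poly W z0" and ?c = "poly P z0"
    obtain P1 where P1: "P - [:?c:] = (W - [:?u:]) * P1"
      using less.prems(3)[OF z0] by (auto elim: dvdE)
    have dW: "degree (W - [:a:]) = degree W" for a
      using less.prems(2) by (simp add: degree_diff_eq_left)
    have dP: "degree (P - [:?c:]) = degree P"
      using False by (simp add: degree_diff_eq_left)
    have nz: "P1 \<noteq> 0" "W - [:?u:] \<noteq> 0"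
      using P1 dP False dW[of ?u] less.prems(2) by auto
    have deg: "degree P1 < degree P"
      using dP less.prems(2) nz by (simp add: P1 degree_mult_eq dW)
    \<comment> \<open>Where \<open>W(z) = W(z0)\<close>, the constant in front of
      \<open>P1 - P1(z)\<close> in the rewriting below vanishes and nothing follows; these finitely
      many points are dropped.\<close>
    define Z' where "Z' = Z - {z. poly (W - [:?u:]) z = 0}"
    have "infinite Z'"
      unfolding Z'_def using less.prems(1) poly_roots_finite[OF nz(2)] by (simp add: Diff_infinite_finite)
    moreover have "(W - [:poly W z:]) dvd (P1 - [:poly P1 z:])" if "z \<in> Z'" for z
    proof -
      let ?w = "poly W z" and ?p = "poly P z"
      have zZ: "z \<in> Z" using that by (simp add: Z'_def)
      have ne: "?w - ?u \<noteq> 0" using that by (simp add: Z'_def)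
      have ev: "?p - ?c = (?w - ?u) * poly P1 z"
        using arg_cong[OF P1, of "\<lambda>f. poly f z"] by simp
      have "P - [:?p:] = (P - [:?c:]) - [:?p - ?c:]" by simp
      also have "\<dots> = (W - [:?u:]) * P1 - smult (?w - ?u) [:poly P1 z:]"
        by (simp add: P1 ev)
      also have "\<dots> = (W - [:?w:]) * P1 + smult (?w - ?u) (P1 - [:poly P1 z:])"
        by (simp add: algebra_simps smult_diff_right smult_diff_left)
      finally have "(W - [:?w:]) dvd (W - [:?w:]) * P1 + smult (?w - ?u) (P1 - [:poly P1 z:])"
        using less.prems(3)[OF zZ] by simp
      then have "(W - [:?w:]) dvd smult (?w - ?u) (P1 - [:poly P1 z:])"
        by (simp add: dvd_add_right_iff)
      then show ?thesis using ne by (simp add: dvd_smult_iff)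
    qed
    ultimately obtain P' where "P1 = P' \<circ>\<^sub>p W"
      using less.hyps[OF deg] less.prems(2) by blast
    moreover have "P = (W - [:?u:]) * P1 + [:?c:]" by (simp flip: P1)
    ultimately have "P = ([:- ?u, 1:] * P' + [:?c:]) \<circ>\<^sub>p W"
      by (simp add: pcompose_mult pcompose_add pcompose_linear del: mult_pCons_left)
    then show ?thesis by blast
  qed
qed

section \<open>The bivariate difference and its greatest common divisors\<close>

text \<open>The bivariate polynomial \<open>P(w) - P(z)\<close>, with \<open>w\<close> the outer and \<open>z\<close> the inner variable.\<close>

definition swap_diff :: "complex poly \<Rightarrow> complex poly poly" where
  "swap_diff P = map_poly (\<lambda>c. [:c:]) P - [:P:]"

lemma poly_map_poly_const: "poly (map_poly (\<lambda>c. [:c:]) P) [:w:] = [:poly P (w::'a::comm_ring_1):]"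
  by (induction P) (auto simp: map_poly_pCons)

lemma poly_swap_diff [simp]: "poly (swap_diff P) [:w:] = [:poly P w:] - P"
  by (simp add: swap_diff_def poly_map_poly_const)

lemma lead_coeff_swap_diff:
  assumes "degree P > 0"
  shows "lead_coeff (swap_diff P) = [:lead_coeff P:]" "degree (swap_diff P) = degree P"
proof -
  have "degree (map_poly (\<lambda>c. [:c:]) P) = degree P" by (simp add: degree_map_poly)
  then show *: "degree (swap_diff P) = degree P"
    using assms by (simp add: swap_diff_def degree_diff_eq_left)
  show "lead_coeff (swap_diff P) = [:lead_coeff P:]"
    unfolding * using assms by (simp add: swap_diff_def coeff_map_poly coeff_eq_0 coeff_pCons split: nat.split)
qed

text \<open>A nonzero element of least degree in the ideal of \<open>f\<close> and \<open>g\<close> divides both up to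
  constants; its primitive part is a greatest common divisor with a Bezout identity.\<close>

lemma bezout_primitive:
  fixes f g :: "complex poly poly"
  assumes "f \<noteq> 0"
  obtains h d s t where "d \<noteq> 0" "h dvd f" "h dvd g" "smult d h = s * f + t * g"
proof -
  define I where "I = {s * f + t * g | s t. True}"
  have I_iff: "x \<in> I \<longleftrightarrow> (\<exists>s t. x = s * f + t * g)" for x by (auto simp: I_def)
  have fI: "f \<in> I" unfolding I_iff by (rule exI[of _ 1], rule exI[of _ 0]) simp
  have gI: "g \<in> I" unfolding I_iff by (rule exI[of _ 0], rule exI[of _ 1]) simp
  have "f \<in> I \<and> f \<noteq> 0" using fI assms by blast
  then obtain m where m: "m \<in> I" "m \<noteq> 0" and least: "\<And>x. x \<in> I \<Longrightarrow> x \<noteq> 0 \<Longrightarrow> degree m \<le> degree x"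
    using ex_has_least_nat[of "\<lambda>x. x \<in> I \<and> x \<noteq> 0" f degree] by blast
  have dvd: "primitive_part m dvd x" if "x \<in> I" for x
  proof -
    obtain a q where aq: "a \<noteq> 0" "smult a x = m * q + pseudo_mod x m"
      and r: "pseudo_mod x m = 0 \<or> degree (pseudo_mod x m) < degree m"
      using pseudo_mod[OF m(2), of x] by blast
    obtain s t where x: "x = s * f + t * g" using \<open>x \<in> I\<close> I_iff by blast
    obtain s' t' where m': "m = s' * f + t' * g" using m(1) I_iff by blast
    have "pseudo_mod x m = smult a x - m * q" using aq by simp
    also have "\<dots> = (smult a s - s' * q) * f + (smult a t - t' * q) * g"
      by (simp add: x m' algebra_simps smult_add_right)
    finally have "pseudo_mod x m \<in> I" unfolding I_iff by blast
    then have "pseudo_mod x m = 0" using r least not_less by blast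
    then have "smult a x = m * q" using aq by simp
    then have "primitive_part (smult a x) = primitive_part m * primitive_part q"
      by (simp add: primitive_part_mult)
    then have "primitive_part m dvd smult (unit_factor a) (primitive_part x)"
      by (simp add: primitive_part_smult)
    moreover obtain v where "unit_factor a * v = 1"
      using \<open>a \<noteq> 0\<close> unit_factor_is_unit by (metis dvdE)
    ultimately have "primitive_part m dvd primitive_part x"
      using dvd_smult[of "primitive_part m" "smult (unit_factor a) (primitive_part x)" v]
      by (simp add: mult.commute)
    then show ?thesis
      by (metis content_times_primitive_part dvd_smult)
  qed
  obtain s t where "m = s * f + t * g" using m(1) I_iff by blast
  then have "smult (content m) (primitive_part m) = s * f + t * g" by simp
  then show thesis using that[of "content m" "primitive_part m"] m(2) dvd fI gI by simp
qed

section \<open>Squarefree complex polynomials and their roots\<close>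

lemma rsquarefree_dvd:
  fixes p q :: "'a::field_char_0 poly"
  assumes "rsquarefree p" "q dvd p"
  shows "rsquarefree q"
  using assms by (fastforce simp: rsquarefree_roots pderiv_mult elim!: dvdE)

lemma rsquarefree_card_roots:
  fixes p :: "complex poly"
  assumes "rsquarefree p"
  shows "card {z. poly p z = 0} = degree p"
proof -
  have nz: "p \<noteq> 0" using assms by (simp add: rsquarefree_def)
  then have fin: "finite {z. poly p z = 0}" by (rule poly_roots_finite)
  have "degree p = degree (smult (lead_coeff p) (\<Prod>z|poly p z = 0. [:-z, 1:]))"
    by (simp only: complex_poly_decompose_rsquarefree[OF assms])
  also have "\<dots> = card {z. poly p z = 0}"
    using nz by (simp add: degree_prod_sum_eq)
  finally show ?thesis by simp
qed

lemma prod_roots_dvd: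
  fixes q :: "'a::idom poly"
  assumes "finite S" "\<And>w. w \<in> S \<Longrightarrow> poly q w = 0"
  shows "(\<Prod>w\<in>S. [:- w, 1:]) dvd q"
  using assms
proof (induction S arbitrary: q)
  case (insert x S)
  obtain r where r: "q = [:- x, 1:] * r"
    using insert.prems[of x] by (auto simp: poly_eq_0_iff_dvd elim: dvdE)
  have "poly r w = 0" if "w \<in> S" for w
    using insert.prems[of w] insert.hyps(2) that by (auto simp: r)
  then have "(\<Prod>w\<in>S. [:- w, 1:]) dvd r" using insert.IH by blast
  then have "[:- x, 1:] * (\<Prod>w\<in>S. [:- w, 1:]) dvd q" unfolding r by (rule mult_dvd_mono[OF dvd_refl])
  then show ?case unfolding prod.insert[OF insert.hyps] .
qed simp

lemma rsquarefree_dvd_if_roots: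
  fixes p q :: "complex poly"
  assumes "rsquarefree p" "\<And>w. poly p w = 0 \<Longrightarrow> poly q w = 0"
  shows "p dvd q"
proof -
  have nz: "p \<noteq> 0" using assms by (simp add: rsquarefree_def)
  have "(\<Prod>w | poly p w = 0. [:- w, 1:]) dvd q"
    using assms nz poly_roots_finite by (intro prod_roots_dvd) auto
  then have "smult (lead_coeff p) (\<Prod>w | poly p w = 0. [:- w, 1:]) dvd q"
    using nz by (simp add: smult_dvd_iff)
  then show ?thesis by (simp only: complex_poly_decompose_rsquarefree[OF assms(1)])
qed

lemma poly_map_poly_poly:
  "poly (map_poly (\<lambda>p. poly p z) G) w = poly (poly G [:w:]) (z::'a::comm_ring_1)"
  by (induction G) (auto simp: map_poly_pCons)

text \<open>A form of Lueroth's theorem. With \<open>G(z, w)\<close> the greatest common divisor of \<open>P(w) - P(z)\<close> and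
  \<open>Q(w) - Q(z)\<close>, the factor is \<open>W(z) = G(z, w\<^sub>0)\<close> for generic \<open>w\<^sub>0\<close>: it takes equal values at all
  common roots, so \<open>W(w) - W(z)\<close> is \<open>G(z, w)\<close> up to a constant.\<close>

lemma common_right_factor:
  fixes P Q :: "complex poly"
  assumes deg: "degree P > 0"
    and inf: "infinite {z. \<exists>w. w \<noteq> z \<and> poly P w = poly P z \<and> poly Q w = poly Q z}"
  obtains P' Q' W where "P = P' \<circ>\<^sub>p W" "Q = Q' \<circ>\<^sub>p W" "degree W \<ge> 2"
proof -
  have "swap_diff P \<noteq> 0" using lead_coeff_swap_diff(2)[OF deg] deg by auto
  then obtain G d s t where d: "d \<noteq> 0" and GP: "G dvd swap_diff P" and GQ: "G dvd swap_diff Q"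
    and bez: "smult d G = s * swap_diff P + t * swap_diff Q"
    by (rule bezout_primitive)
  obtain H where H: "swap_diff P = G * H" using GP by (auto elim: dvdE)
  obtain H' where H': "swap_diff Q = G * H'" using GQ by (auto elim: dvdE)
  \<comment> \<open>As a polynomial in \<open>w\<close>, \<open>P(w) - P(z)\<close> has a nonzero
    constant as leading coefficient, hence so has its divisor \<open>G\<close>; specialising
    \<open>z\<close> therefore preserves the degree in \<open>w\<close>.\<close>
  have "lead_coeff G * lead_coeff H = [:lead_coeff P:]"
    using lead_coeff_swap_diff(1)[OF deg] by (simp add: H lead_coeff_mult)
  moreover have "[:lead_coeff P:] dvd 1" using deg
    by (auto simp: is_unit_const_poly_iff dvd_field_iff)
  ultimately have "lead_coeff G dvd 1" by (metis dvd_triv_left dvd_trans)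
  then obtain g where g: "lead_coeff G = [:g:]" "g \<noteq> 0"
    by (metis is_unit_poly_iff dvd_0_left_iff zero_neq_one pCons_0_0 is_unit_pCons_iff)
  define S where "S z = {w. poly P w = poly P z \<and> poly Q w = poly Q z}" for z
  define gz where "gz z = map_poly (\<lambda>p. poly p z) G" for z
  have gz_eval: "poly (gz z) w = poly (poly G [:w:]) z" for z w
    by (simp add: gz_def poly_map_poly_poly)
  have gz_roots: "poly (gz z) w = 0 \<Longrightarrow> w \<in> S z" for z w
    using arg_cong[OF H, of "\<lambda>F. poly (poly F [:w:]) z"] arg_cong[OF H', of "\<lambda>F. poly (poly F [:w:]) z"]
    by (simp add: gz_eval S_def)
  have bez': "poly d z * poly (gz z) w = poly (poly s [:w:]) z * (poly P w - poly P z)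
      + poly (poly t [:w:]) z * (poly Q w - poly Q z)" for z w
    using arg_cong[OF bez, of "\<lambda>F. poly (poly F [:w:]) z"] by (simp add: gz_eval)
  have deg_gz: "degree (gz z) = degree G" "lead_coeff (gz z) = g" for z
  proof -
    show "degree (gz z) = degree G"
      unfolding gz_def using g by (intro map_poly_degree_eq) auto
    then show "lead_coeff (gz z) = g"
      using g by (simp add: gz_def coeff_map_poly)
  qed
  have gz_dvd: "gz z dvd P - [:poly P z:]" "gz z dvd Q - [:poly Q z:]" for z
  proof -
    have "P - [:poly P z:] = gz z * map_poly (\<lambda>p. poly p z) H"
      using arg_cong[OF H, of "\<lambda>F. poly (poly F [:w:]) z" for w]
      by (simp add: poly_eq_poly_eq_iff[symmetric] fun_eq_iff gz_def poly_map_poly_poly)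
    then show "gz z dvd P - [:poly P z:]" by simp
    have "Q - [:poly Q z:] = gz z * map_poly (\<lambda>p. poly p z) H'"
      using arg_cong[OF H', of "\<lambda>F. poly (poly F [:w:]) z" for w]
      by (simp add: poly_eq_poly_eq_iff[symmetric] fun_eq_iff gz_def poly_map_poly_poly)
    then show "gz z dvd Q - [:poly Q z:]" by simp
  qed
  have pd: "pderiv P \<noteq> 0" using deg by (simp add: pderiv_eq_0_iff)
  \<comment> \<open>A finite union of full fibres of \<open>P\<close>: those through a zero of
    \<open>pderiv P\<close> or of \<open>d\<close>. Off it, the roots of \<open>P - P(z)\<close> are
    simple and the Bezout identity makes \<open>gz z\<close> vanish on all of \<open>S z\<close>;
    being a union of fibres, it lets these properties pass from \<open>z\<close> to every point of
    \<open>S z\<close>.\<close>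
  define bad where "bad = (\<Union>w \<in> {w. poly (pderiv P * d) w = 0}. {z. poly (P - [:poly P w:]) z = 0})"
  have P_const: "P - [:c:] \<noteq> 0" for c using deg by auto
  have "finite bad"
    unfolding bad_def using pd d P_const
    by (intro finite_UN_I poly_roots_finite) auto
  have good: "poly (pderiv P) w \<noteq> 0" "poly d w \<noteq> 0" if "z \<notin> bad" "poly P w = poly P z" for z w
    using that by (auto simp: bad_def)
  have good_trans: "w \<notin> bad" if "z \<notin> bad" "poly P w = poly P z" for z w
    using that by (auto simp: bad_def)
  have sqf: "rsquarefree (P - [:poly P z:])" if "z \<notin> bad" for z
    unfolding rsquarefree_roots using good(1)[OF that] by (auto simp: pderiv_diff pderiv_pCons)
  have roots: "{w. poly (gz z) w = 0} = S z" if "z \<notin> bad" for z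
  proof -
    have "poly (gz z) w = 0" if "w \<in> S z" for w
      using bez'[of z w] that good(2)[OF \<open>z \<notin> bad\<close>, of z] by (auto simp: S_def)
    then show ?thesis using gz_roots by blast
  qed
  have sqf_gz: "rsquarefree (gz z)" if "z \<notin> bad" for z
    using sqf[OF that] gz_dvd(1) rsquarefree_dvd by blast
  have card_S: "card (S z) = degree G" if "z \<notin> bad" for z
    using rsquarefree_card_roots[OF sqf_gz[OF that]] roots[OF that] deg_gz(1) by simp
  \<comment> \<open>All points of \<open>S z\<close> have the same set \<open>S\<close>, and off
    \<open>bad\<close> the polynomial \<open>gz\<close> is determined by its simple roots and its
    leading coefficient \<open>g\<close>.\<close>
  have gz_eq: "gz w = gz z" if "z \<notin> bad" "w \<in> S z" for z w
  proof -
    have w: "w \<notin> bad" "S w = S z" using that good_trans by (auto simp: S_def)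
    have "smult g (\<Prod>x\<in>S y. [:- x, 1:]) = gz y" if "y \<notin> bad" for y
      using complex_poly_decompose_rsquarefree[OF sqf_gz[OF that]] roots[OF that] deg_gz(2) by simp
    from this[OF w(1)] this[OF that(1)] w(2) show ?thesis by simp
  qed
  have "infinite (UNIV - bad)" using \<open>finite bad\<close> by (simp add: infinite_UNIV_char_0)
  then obtain w0 where w0: "w0 \<notin> bad" by (metis DiffD2 finite.emptyI ex_in_conv)
  define W where "W = poly G [:w0:]"
  have W_eval: "poly W z = poly (gz z) w0" for z by (simp add: W_def gz_eval)
  \<comment> \<open>As a divisor of a squarefree polynomial, \<open>W\<close> has simple roots; they
    all lie in \<open>S w0\<close>, which bounds the degree of \<open>W\<close> by that of
    \<open>G\<close>.\<close>
  have W_dvd: "W dvd P - [:poly P w0:]"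
    using arg_cong[OF H, of "\<lambda>F. - poly F [:w0:]"] by (simp add: W_def)
  have W_sqf: "rsquarefree W" using sqf[OF w0] W_dvd rsquarefree_dvd by blast
  have "{z. poly W z = 0} \<subseteq> S w0"
    by (auto simp: W_eval S_def dest!: gz_roots)
  moreover have "finite (S w0)"
    using roots[OF w0] poly_roots_finite[of "gz w0"] sqf_gz[OF w0] by (simp add: rsquarefree_def)
  ultimately have deg_W: "degree W \<le> degree G"
    using rsquarefree_card_roots[OF W_sqf] card_S[OF w0] by (metis card_mono)
  have "poly W w0 = 0" using roots[OF w0] by (auto simp: W_eval S_def)
  then have W_pos: "degree W > 0"
    using W_sqf by (auto simp: rsquarefree_def intro!: Nat.gr0I elim!: degree_eq_zeroE)
  \<comment> \<open>\<open>W\<close> is constant on the roots of the squarefree \<open>gz z\<close>,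
    so \<open>gz z\<close> divides \<open>W - W(z)\<close>. The bound \<open>deg_W\<close> forces
    the cofactor to be a nonzero constant, which reverses the divisibility.\<close>
  have W_fac: "(W - [:poly W z:]) dvd gz z" "degree W = degree G" if "z \<notin> bad" for z
  proof -
    have nz: "W - [:poly W z:] \<noteq> 0"
      using W_pos by (metis degree_pCons_0 less_irrefl right_minus_eq)
    have dW: "degree (W - [:poly W z:]) = degree W" using W_pos by (simp add: degree_diff_eq_left)
    have "poly (W - [:poly W z:]) w = 0" if "poly (gz z) w = 0" for w
    proof -
      have "w \<in> S z" using that by (rule gz_roots)
      then have "gz w = gz z" using gz_eq[OF \<open>z \<notin> bad\<close>] by blast
      then show ?thesis by (simp add: W_eval)
    qed
    then have "gz z dvd (W - [:poly W z:])"
      using rsquarefree_dvd_if_roots[OF sqf_gz[OF that]] by blast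
    then obtain r where r: "W - [:poly W z:] = gz z * r" by (auto elim: dvdE)
    have "degree W = degree G + degree r"
      using nz dW deg_gz(1)[of z] by (simp add: r degree_mult_eq)
    then have *: "degree W = degree G" "degree r = 0" using deg_W by auto
    then obtain c where c: "r = [:c:]" by (metis degree_eq_zeroE)
    then have "c \<noteq> 0" using nz r by auto
    then have "gz z = (W - [:poly W z:]) * [:inverse c:]" by (simp add: r c)
    then show "(W - [:poly W z:]) dvd gz z" by (metis dvd_triv_left)
    show "degree W = degree G" by (rule *)
  qed
  obtain P' where "P = P' \<circ>\<^sub>p W"
  proof -
    have "(W - [:poly W z:]) dvd P - [:poly P z:]" if "z \<in> UNIV - bad" for z
      using W_fac(1)[of z] gz_dvd(1)[of z] that by (auto intro: dvd_trans)
    from pcompose_if_dvd_diffs[OF \<open>infinite (UNIV - bad)\<close> W_pos this] show thesis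
      using that by blast
  qed
  moreover obtain Q' where "Q = Q' \<circ>\<^sub>p W"
  proof -
    have "(W - [:poly W z:]) dvd Q - [:poly Q z:]" if "z \<in> UNIV - bad" for z
      using W_fac(1)[of z] gz_dvd(2)[of z] that by (auto intro: dvd_trans)
    from pcompose_if_dvd_diffs[OF \<open>infinite (UNIV - bad)\<close> W_pos this] show thesis
      using that by blast
  qed
  moreover have "degree W \<ge> 2"
  proof -
    have "\<not> {z. \<exists>w. w \<noteq> z \<and> poly P w = poly P z \<and> poly Q w = poly Q z} \<subseteq> bad"
      using \<open>finite bad\<close> inf finite_subset by blast
    then obtain z where z: "z \<notin> bad" "\<exists>w. w \<noteq> z \<and> poly P w = poly P z \<and> poly Q w = poly Q z"
      by blast
    then obtain w where w: "w \<noteq> z" "{w, z} \<subseteq> S z" by (auto simp: S_def)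
    moreover have "finite (S z)"
      using roots[OF z(1)] poly_roots_finite[of "gz z"] sqf_gz[OF z(1)] by (simp add: rsquarefree_def)
    ultimately have "card {w, z} \<le> card (S z)" by (metis card_mono)
    then show ?thesis using w(1) card_S[OF z(1)] W_fac(2)[OF z(1)] by simp
  qed
  ultimately show thesis by (rule that)
qed

subsection \<open>The mountain pass level\<close>

abbreviation sublevel :: "complex poly \<Rightarrow> real \<Rightarrow> complex set" where
  "sublevel P r \<equiv> {z. norm (poly P z) < r}"

lemma open_sublevel: "open (sublevel P r)"
  by (intro open_Collect_less continuous_intros)

lemma bounded_sublevel:
  fixes P :: "complex poly"
  assumes "degree P > 0"
  shows "bounded {z. norm (poly P z) \<le> r}"
proof -
  obtain a p where P: "P = pCons a p" "p \<noteq> 0"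
    using assms by (cases P) (auto split: if_splits)
  obtain R where "\<And>z. R \<le> norm z \<Longrightarrow> r + 1 \<le> norm (poly P z)"
    using poly_infinity[OF P(2), of "r + 1" a] P(1) by auto
  then have "{z. norm (poly P z) \<le> r} \<subseteq> ball 0 R"
    by (force simp: not_le[symmetric])
  then show ?thesis using bounded_ball bounded_subset by blast
qed

lemma sublevel_component_mono:
  assumes "connected_component (sublevel P r) x y" "r \<le> s"
  shows "connected_component (sublevel P s) x y"
  by (rule connected_component_of_subset[OF assms(1)]) (use assms(2) in auto)

text \<open>Components of an open set are path connected, and on the compact image of a path
  \<open>norm (poly P z)\<close> attains a maximum, which is still below \<open>M\<close>.\<close>

lemma sublevel_component_shrink:
  assumes "connected_component (sublevel P M) x y"
  obtains r where "r < M" "connected_component (sublevel P r) x y"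
proof -
  have "path_component (sublevel P M) x y"
    using assms open_sublevel open_imp_locally_path_connected path_component_eq_connected_component by metis
  then obtain g where g: "path g" "path_image g \<subseteq> sublevel P M" "pathstart g = x" "pathfinish g = y"
    unfolding path_component_def by blast
  have "compact (path_image g)" "path_image g \<noteq> {}"
    using g by (auto simp: compact_path_image)
  moreover have "continuous_on (path_image g) (\<lambda>z. norm (poly P z))"
    by (intro continuous_intros)
  ultimately obtain z where z: "z \<in> path_image g" "\<forall>w\<in>path_image g. norm (poly P w) \<le> norm (poly P z)"
    using continuous_attains_sup by blast
  define r where "r = (norm (poly P z) + M) / 2"
  have "norm (poly P z) < M" using z(1) g(2) by auto
  then have r: "r < M" "norm (poly P z) < r" by (auto simp: r_def)
  have "path_image g \<subseteq> sublevel P r" using z(2) r(2) by force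
  moreover have "x \<in> path_image g" "y \<in> path_image g" using g(3,4) by (metis pathstart_in_path_image pathfinish_in_path_image)+
  ultimately have "connected_component (sublevel P r) x y"
    unfolding connected_component_def using connected_path_image[OF g(1)] by blast
  then show thesis using that r(1) by blast
qed

text \<open>Being within \<open>O(r ^ k)\<close> of each other is an equivalence relation on points.
  The mean value inequality gives it on small balls inside the sublevel set, and connectedness
  spreads it, with no need to estimate along a path. The constant depends on the two points but not
  on \<open>k\<close>.\<close>

lemma moment_difference_bound:
  fixes G :: "nat \<Rightarrow> complex poly"
  assumes "connected_component (sublevel P r) x y"
    and G: "\<And>k. pderiv (G k) = P ^ k * q"
  shows "\<exists>C. \<forall>k. norm (poly (G k) x - poly (G k) y) \<le> C * r ^ k"
proof -
  obtain T where T: "connected T" "T \<subseteq> sublevel P r" "x \<in> T" "y \<in> T"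
    using assms(1) unfolding connected_component_def by blast
  define R where "R x y \<longleftrightarrow> (\<exists>C. \<forall>k. norm (poly (G k) x - poly (G k) y) \<le> C * r ^ k)" for x y
  have "R x y"
  proof (rule connected_equivalence_relation[OF T(1,3,4)])
    show "R x y \<Longrightarrow> R y x" for x y by (simp add: R_def norm_minus_commute)
    show "R x z" if xy: "R x y" and yz: "R y z" for x y z
    proof -
      obtain C where C: "\<And>k. norm (poly (G k) x - poly (G k) y) \<le> C * r ^ k" using xy R_def by blast
      obtain C' where C': "\<And>k. norm (poly (G k) y - poly (G k) z) \<le> C' * r ^ k" using yz R_def by blast
      have "norm (poly (G k) x - poly (G k) z) \<le> (C + C') * r ^ k" for k
        using C[of k] C'[of k] norm_diff_triangle_ineq[of "poly (G k) x" "poly (G k) y" "poly (G k) y" "poly (G k) z"]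
        by (simp add: algebra_simps)
      then show ?thesis unfolding R_def by blast
    qed
    fix a assume "a \<in> T"
    then have "a \<in> sublevel P r" using T(2) by blast
    then obtain e where e: "e > 0" "cball a e \<subseteq> sublevel P r"
      using open_sublevel open_contains_cball by metis
    have "compact ((\<lambda>z. poly q z) ` cball a e)"
      by (intro compact_continuous_image continuous_intros compact_cball)
    then obtain K where K: "\<And>z. z \<in> cball a e \<Longrightarrow> norm (poly q z) \<le> K"
      by (meson bounded_iff compact_imp_bounded imageI)
    have r0: "r > 0" using \<open>a \<in> sublevel P r\<close> by (smt (verit, best) mem_Collect_eq norm_ge_zero)
    have "R a z" if "z \<in> ball a e" for z
    proof -
      have "norm (poly (G k) a - poly (G k) z) \<le> (K * r ^ k) * norm (a - z)" for k
      proof (rule field_differentiable_bound[of "cball a e" "poly (G k)" "\<lambda>z. poly (P ^ k * q) z"])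
        show "(poly (G k) has_field_derivative poly (P ^ k * q) w) (at w within cball a e)" for w
          using poly_DERIV[of "G k" w] by (simp add: G has_field_derivative_at_within)
        show "norm (poly (P ^ k * q) w) \<le> K * r ^ k" if "w \<in> cball a e" for w
        proof -
          have "norm (poly P w) ^ k \<le> r ^ k"
            using e(2) that by (intro power_mono) (auto intro: less_imp_le)
          then have "norm (poly P w) ^ k * norm (poly q w) \<le> r ^ k * K"
            using K[OF that] r0 by (intro mult_mono) auto
          then show ?thesis by (simp add: norm_mult norm_power mult.commute)
        qed
      qed (use that e in auto)
      then have "norm (poly (G k) a - poly (G k) z) \<le> (K * norm (a - z)) * r ^ k" for k
        by (simp add: mult_ac)
      then show ?thesis unfolding R_def by blast
    qed
    then show "\<exists>S. openin (top_of_set T) S \<and> a \<in> S \<and> (\<forall>x\<in>S. R a x)"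
      using \<open>a \<in> T\<close> e(1) by (intro exI[of _ "T \<inter> ball a e"]) auto
  qed
  then show ?thesis by (simp add: R_def)
qed

text \<open>By the open mapping theorem, arbitrarily close to \<open>z\<close> the polynomial takes
  values \<open>(1 - t) P(z)\<close>, which are shrunk towards 0.\<close>

lemma closure_sublevel:
  assumes "degree P > 0" "M > 0" "norm (poly P z) \<le> M"
  shows "z \<in> closure (sublevel P M)"
  unfolding closure_approachable
proof (intro allI impI)
  fix e :: real assume "e > 0"
  have "open (poly P ` ball z e)"
  proof (rule open_mapping_thm[of "poly P" UNIV])
    show "\<not> poly P constant_on UNIV"
    proof
      assume "poly P constant_on UNIV"
      then obtain c where "\<And>x. poly P x = c" by (auto simp: constant_on_def)
      then have "P = [:c:]" by (simp add: poly_eq_poly_eq_iff[symmetric] fun_eq_iff)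
      then show False using assms(1) by simp
    qed
  qed (auto intro!: holomorphic_intros)
  moreover have "poly P z \<in> poly P ` ball z e" using \<open>e > 0\<close> by auto
  ultimately obtain d where d: "d > 0" "ball (poly P z) d \<subseteq> poly P ` ball z e"
    by (meson open_contains_ball)
  \<comment> \<open>The shrunk value lies at distance at most \<open>t * M\<close> from
    \<open>P(z)\<close>, so \<open>t * M \<le> d / 2\<close> keeps it in the ball covered by the
    image.\<close>
  define t where "t = min (1/2) (d / (2 * M))"
  have t: "0 < t" "t \<le> 1/2" "t * M \<le> d / 2"
    using d(1) assms(2) by (auto simp: t_def min_def field_simps)
  have "dist (poly P z) (of_real (1 - t) * poly P z) = t * norm (poly P z)"
    using t by (simp add: dist_norm algebra_simps norm_mult)
  also have "\<dots> \<le> t * M" using t assms(3) by (intro mult_left_mono) auto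
  also have "\<dots> < d" using t d by linarith
  finally obtain y where y: "y \<in> ball z e" "poly P y = of_real (1 - t) * poly P z"
    using d(2) by (metis imageE mem_ball subsetD)
  have "norm (poly P y) = (1 - t) * norm (poly P z)"
    using t by (simp add: y(2) norm_mult flip: of_real_diff)
  also have "\<dots> \<le> (1 - t) * M" using t assms(3) by (intro mult_left_mono) auto
  also have "\<dots> < M" using t assms(2) by simp
  finally show "\<exists>y\<in>sublevel P M. dist y z < e" using y(1) by (auto simp: dist_commute)
qed

text \<open>If the component \<open>A\<close> of \<open>a\<close> and the rest \<open>B\<close> of
  the sublevel set had disjoint closures, disjoint open sets around them would still cover a
  slightly higher sublevel set, where \<open>a\<close> and \<open>b\<close> are connected. So the
  closures meet, and a common point lies in neither open set, that is, exactly on the level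
  \<open>M\<close>.\<close>

lemma mountain_pass:
  assumes deg: "degree P > 0" and a: "norm (poly P a) < M" and b: "norm (poly P b) < M"
    and sep: "\<not> connected_component (sublevel P M) a b"
    and conn: "\<And>r. r > M \<Longrightarrow> connected_component (sublevel P r) a b"
  obtains v where "norm (poly P v) = M"
    and "v \<in> closure (connected_component_set (sublevel P M) a)"
    and "v \<in> closure (sublevel P M - connected_component_set (sublevel P M) a)"
proof -
  define A where "A = connected_component_set (sublevel P M) a"
  define B where "B = sublevel P M - A"
  have M: "M > 0" using a by (smt (verit) norm_ge_zero)
  have AB: "a \<in> A" "b \<in> B" "A \<subseteq> sublevel P M"
    using a b sep connected_component_subset by (auto simp: A_def B_def)
  have openA: "open A" unfolding A_def by (rule open_connected_component[OF open_sublevel])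
  have openB: "open B"
  proof -
    have "\<exists>T. open T \<and> x \<in> T \<and> T \<subseteq> B" if "x \<in> B" for x
    proof (intro exI conjI)
      show "open (connected_component_set (sublevel P M) x)"
        by (rule open_connected_component[OF open_sublevel])
      have x: "x \<in> sublevel P M" "\<not> connected_component (sublevel P M) a x"
        using that by (auto simp: B_def A_def)
      then show "x \<in> connected_component_set (sublevel P M) x"
        using connected_component_refl_eq by (metis mem_Collect_eq)
      have "\<not> connected_component (sublevel P M) a y" if "connected_component (sublevel P M) x y" for y
        using that x(2) connected_component_sym connected_component_trans by metis
      then show "connected_component_set (sublevel P M) x \<subseteq> B"
        using connected_component_subset by (force simp: B_def A_def)
    qed
    then show ?thesis by (subst open_subopen) blast
  qed
  have "closure A \<inter> closure B \<noteq> {}"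
  proof
    assume disj: "closure A \<inter> closure B = {}"
    have bd: "bounded (sublevel P M)"
      by (rule bounded_subset[OF bounded_sublevel[OF deg, of M]]) auto
    then have "compact (closure A)" "closed (closure B)"
      using AB(3) bounded_subset compact_closure by auto
    then obtain V1 V2 where V: "open V1" "open V2" "closure A \<subseteq> V1" "closure B \<subseteq> V2" "V1 \<inter> V2 = {}"
      using disj separation_normal[of "closure A" "closure B"] by auto
    have "closure (sublevel P M) = closure A \<union> closure B"
      using AB(3) by (metis B_def Diff_partition closure_Un)
    then have cov: "{z. norm (poly P z) \<le> M} \<subseteq> V1 \<union> V2"
      using V closure_sublevel[OF deg M] by blast
    \<comment> \<open>The compact uncovered part up to level \<open>M + 1\<close>. If nonempty, its
      least value of \<open>norm (poly P z)\<close> exceeds \<open>M\<close> and serves as the level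
      \<open>r\<close>.\<close>
    define C where "C = {z. norm (poly P z) \<le> M + 1} - (V1 \<union> V2)"
    have "closed {z. norm (poly P z) \<le> M + 1}" by (intro closed_Collect_le continuous_intros)
    then have "compact C"
      unfolding C_def using V bounded_sublevel[OF deg, of "M + 1"]
      by (intro compact_diff) (auto simp: compact_eq_bounded_closed)
    obtain r where r: "r > M" "sublevel P r \<subseteq> V1 \<union> V2"
    proof (cases "C = {}")
      case True
      then have "z \<in> V1 \<union> V2" if "norm (poly P z) \<le> M + 1" for z
        using that unfolding C_def by blast
      then show thesis using that[of "M + 1"] by force
    next
      case False
      have "continuous_on C (\<lambda>z. norm (poly P z))" by (intro continuous_intros)
      then obtain z where z: "z \<in> C" "\<forall>w\<in>C. norm (poly P z) \<le> norm (poly P w)"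
        using continuous_attains_inf[OF \<open>compact C\<close> False] by blast
      have "\<not> norm (poly P z) \<le> M" "norm (poly P z) \<le> M + 1"
        using z(1) cov by (auto simp: C_def)
      then have "M < norm (poly P z)" "norm (poly P z) \<le> M + 1" by simp_all
      moreover have "sublevel P (norm (poly P z)) \<subseteq> V1 \<union> V2"
      proof
        fix w assume "w \<in> sublevel P (norm (poly P z))"
        then have w: "norm (poly P w) < norm (poly P z)" by simp
        then have "w \<notin> C" using z(2) not_less by blast
        then show "w \<in> V1 \<union> V2" using w \<open>norm (poly P z) \<le> M + 1\<close> by (auto simp: C_def)
      qed
      ultimately show thesis using that by blast
    qed
    obtain T where T: "connected T" "T \<subseteq> sublevel P r" "a \<in> T" "b \<in> T"
      using conn[OF r(1)] unfolding connected_component_def by blast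
    have "a \<in> V1" "b \<in> V2" using AB V closure_subset by blast+
    then show False
      using connectedD[OF T(1) V(1,2)] T r(2) V(5) by blast
  qed
  then obtain v where v: "v \<in> closure A" "v \<in> closure B" by blast
  have "norm (poly P v) \<le> M"
  proof -
    have "closed {z. norm (poly P z) \<le> M}" by (intro closed_Collect_le continuous_intros)
    then have "closure A \<subseteq> {z. norm (poly P z) \<le> M}"
      using AB(3) by (intro closure_minimal) auto
    then show ?thesis using v(1) by auto
  qed
  moreover have "v \<notin> A" using v(2) openA by (metis B_def DiffD2 disjoint_iff open_Int_closure_eq_empty)
  moreover have "v \<notin> B" using v(1) openB by (metis B_def DiffD2 disjoint_iff open_Int_closure_eq_empty)
  ultimately have "norm (poly P v) = M" by (auto simp: B_def)
  then show thesis using that v by (simp add: A_def B_def)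
qed

section \<open>Local normal form and sectors\<close>

text \<open>With \<open>m\<close> the vanishing order of \<open>P - P(v)\<close> at
  \<open>v\<close>, this difference is the \<open>m\<close>-th power of a function \<open>h\<close>
  with a simple zero at \<open>v\<close>; \<open>\<zeta>\<close> is a local inverse of
  \<open>h\<close>.\<close>

lemma local_coordinate:
  fixes P :: "complex poly" and v :: complex
  assumes deg: "degree P > 0"
  obtains m \<rho> \<zeta> where "m > 0" "\<rho> > 0" "\<zeta> holomorphic_on ball 0 \<rho>" "inj_on \<zeta> (ball 0 \<rho>)" "\<zeta> 0 = v"
    and "\<And>u. u \<in> ball 0 \<rho> \<Longrightarrow> poly P (\<zeta> u) = poly P v + u ^ m"
proof -
  have "\<exists>n>0. (deriv ^^ n) (poly P) v \<noteq> 0"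
  proof (rule ccontr)
    assume "\<not> ?thesis"
    then have der: "(deriv ^^ n) (poly P) v = 0" if "n > 0" for n using that by blast
    have "poly P w = poly P v" for w
      by (rule holomorphic_fun_eq_const_on_connected[of "poly P" UNIV, OF _ _ _ der])
        (auto intro!: holomorphic_intros)
    then have "P = [:poly P v:]" by (simp add: poly_eq_poly_eq_iff[symmetric] fun_eq_iff)
    then show False using deg by (metis degree_pCons_0 less_irrefl)
  qed
  then obtain m where m: "m > 0" "(deriv ^^ m) (poly P) v \<noteq> 0"
    and least: "\<And>i. 0 < i \<Longrightarrow> i < m \<Longrightarrow> (deriv ^^ i) (poly P) v = 0"
    using exists_least_iff[of "\<lambda>n. n > 0 \<and> (deriv ^^ n) (poly P) v \<noteq> 0"] by blast
  have "poly P holomorphic_on UNIV" by (auto intro!: holomorphic_intros)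
  from this open_UNIV UNIV_I m
  obtain g r where r: "0 < r" and holg: "g holomorphic_on ball v r"
    and fac: "\<And>w. w \<in> ball v r \<Longrightarrow> poly P w - poly P v = ((w - v) * g w) ^ m"
    and g: "\<And>w. w \<in> ball v r \<Longrightarrow> g w \<noteq> 0"
  proof (rule holomorphic_factor_order_of_zero_strong)
    show "\<And>i. 0 < i \<Longrightarrow> i < m \<Longrightarrow> (deriv ^^ i) (poly P) v = 0" by (rule least)
  qed (rule that)
  define h where "h w = (w - v) * g w" for w
  have holh: "h holomorphic_on ball v r"
    unfolding h_def by (intro holomorphic_intros holg)
  have "(g has_field_derivative deriv g v) (at v)"
    using holg r by (auto intro!: holomorphic_derivI)
  then have "(h has_field_derivative g v) (at v)"
    unfolding h_def by (auto intro!: derivative_eq_intros)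
  then have "deriv h v \<noteq> 0" using g r by (simp add: DERIV_imp_deriv)
  then obtain s where s: "s > 0" "ball v s \<subseteq> ball v r" "inj_on h (ball v s)"
    using has_complex_derivative_locally_injective[OF holh _ open_ball] r by (metis centre_in_ball)
  have holh': "h holomorphic_on ball v s" using holh s holomorphic_on_subset by blast
  obtain k where k: "k holomorphic_on h ` ball v s" "\<And>z. z \<in> ball v s \<Longrightarrow> k (h z) = z"
    using holomorphic_has_inverse[OF holh' open_ball s(3)] by metis
  have "open (h ` ball v s)" by (rule open_mapping_thm3[OF holh' open_ball s(3)])
  moreover have "0 \<in> h ` ball v s" using s(1) by (auto simp: h_def image_iff intro!: bexI[of _ v])
  ultimately obtain \<rho> where \<rho>: "\<rho> > 0" "ball 0 \<rho> \<subseteq> h ` ball v s"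
    by (meson open_contains_ball)
  have hk: "h (k u) = u" "k u \<in> ball v s" if u: "u \<in> ball 0 \<rho>" for u
  proof -
    obtain z where "z \<in> ball v s" "u = h z" using u \<rho>(2) by blast
    then show "h (k u) = u" "k u \<in> ball v s" using k(2)[of z] by simp_all
  qed
  show thesis
  proof (rule that[OF m(1) \<rho>(1), of k])
    show "k holomorphic_on ball 0 \<rho>" using k(1) \<rho>(2) holomorphic_on_subset by blast
    show "inj_on k (ball 0 \<rho>)" by (rule inj_on_inverseI[of _ h]) (rule hk(1))
    show "k 0 = v" using k(2)[of v] s(1) by (simp add: h_def)
    show "poly P (k u) = poly P v + u ^ m" if "u \<in> ball 0 \<rho>" for u
      using fac[of "k u"] hk[OF that] s(2) by (auto simp: h_def algebra_simps)
  qed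
qed

text \<open>In the coordinate \<open>u\<close> with \<open>P = c + u ^ m\<close>, the part of the sublevel set near \<open>v\<close> falls into
  \<open>m\<close> sectors, each containing exactly one ray \<open>u = \<alpha> t\<close> with \<open>\<alpha> ^ m = - c\<close>.\<close>

lemma sector_ray:
  fixes P :: "complex poly" and \<zeta> :: "complex \<Rightarrow> complex"
  assumes "m > 0" "\<zeta> holomorphic_on ball 0 \<rho>"
    and P: "\<And>u. u \<in> ball 0 \<rho> \<Longrightarrow> poly P (\<zeta> u) = c + u ^ m"
    and z: "z \<in> \<zeta> ` ball 0 \<rho>" "norm (poly P z) < norm c"
  obtains \<alpha> where "\<alpha> ^ m = - c"
    and "\<And>t. 0 < t \<Longrightarrow> t < 1 \<Longrightarrow> norm \<alpha> * t < \<rho> \<Longrightarrow>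
           connected_component (sublevel P (norm c)) z (\<zeta> (\<alpha> * of_real t))"
proof -
  obtain u where u: "z = \<zeta> u" "norm u < \<rho>" using z(1) by auto
  have c: "c \<noteq> 0" using z(2) by auto
  \<comment> \<open>In the variable \<open>y = - u ^ m / c\<close> the sublevel condition reads
    \<open>|1 - y| < 1\<close> and the coordinate disc \<open>|y| < \<rho> ^ m / |c|\<close>. The
    intersection is convex and lies in the right half plane, where the principal \<open>m\<close>-th
    root is continuous.\<close>
  define Y :: "complex set" where "Y = ball 1 1 \<inter> ball 0 (\<rho> ^ m / norm c)"
  define root where "root y = exp (Ln y / of_nat m)" for y
  have Y_pos: "Re y > 0" if "y \<in> Y" for y
  proof -
    have "\<bar>Re (1 - y)\<bar> < 1"
      using that abs_Re_le_cmod[of "1 - y"] by (auto simp: Y_def dist_norm simp del: minus_complex.sel)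
    then show ?thesis by auto
  qed
  have root_pow: "root y ^ m = y" if "y \<in> Y" for y
    using Y_pos[OF that] \<open>m > 0\<close> by (auto simp: root_def exp_of_nat_mult[symmetric] intro: exp_Ln)
  define y where "y = - (u ^ m / c)"
  have Pz: "poly P z = c + u ^ m" using u P by simp
  have yY: "y \<in> Y"
  proof -
    have "1 - y = poly P z / c" using c by (simp add: y_def Pz field_simps)
    then have "norm (1 - y) < 1" using z(2) c by (simp add: norm_divide)
    moreover have "norm y < \<rho> ^ m / norm c"
      using u(2) c \<open>m > 0\<close> by (auto simp: y_def norm_divide norm_power intro!: divide_strict_right_mono power_strict_mono)
    ultimately show ?thesis by (simp add: Y_def dist_norm)
  qed
  \<comment> \<open>The \<open>m\<close>-th root of \<open>- c\<close> that selects the sector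
    containing \<open>z\<close>: \<open>u\<close> is \<open>\<alpha>\<close> times the principal
    root of \<open>y\<close>.\<close>
  define \<alpha> where "\<alpha> = u / root y"
  have root_nz: "root x \<noteq> 0" for x by (simp add: root_def)
  have "y \<noteq> 0" using Y_pos[OF yY] by auto
  have "u ^ m = - c * y" using c by (simp add: y_def)
  then have \<alpha>: "\<alpha> ^ m = - c"
    using root_pow[OF yY] \<open>y \<noteq> 0\<close> by (simp add: \<alpha>_def power_divide)
  have \<rho>: "\<rho> > 0" using u(2) by (smt (verit) norm_ge_zero)
  have in_ball: "\<alpha> * root x \<in> ball 0 \<rho>" if "x \<in> Y" for x
  proof -
    have "norm (\<alpha> * root x) ^ m = norm (\<alpha> ^ m) * norm (root x ^ m)"
      by (simp add: norm_mult norm_power power_mult_distrib)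
    also have "\<dots> = norm c * norm x" by (simp add: \<alpha> root_pow[OF that])
    also have "\<dots> < \<rho> ^ m" using that c by (simp add: Y_def field_simps)
    finally have "norm (\<alpha> * root x) < \<rho>" using \<rho> by (metis power_less_imp_less_base less_imp_le)
    then show ?thesis by simp
  qed
  define T where "T = (\<lambda>x. \<zeta> (\<alpha> * root x)) ` Y"
  have "connected T"
    unfolding T_def
  proof (rule connected_continuous_image)
    have "x \<notin> \<real>\<^sub>\<le>\<^sub>0" if "x \<in> Y" for x
      using Y_pos[OF that] by (auto simp: complex_nonpos_Reals_iff)
    then have "continuous_on Y (\<lambda>x. \<alpha> * root x)"
      unfolding root_def using \<open>m > 0\<close> by (intro continuous_intros) auto
    then show "continuous_on Y (\<lambda>x. \<zeta> (\<alpha> * root x))"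
      by (rule continuous_on_compose2[OF holomorphic_on_imp_continuous_on[OF assms(2)]])
        (use in_ball in blast)
    show "connected Y" unfolding Y_def by (intro convex_connected convex_Int convex_ball)
  qed
  moreover have "T \<subseteq> sublevel P (norm c)"
  proof
    fix w assume "w \<in> T"
    then obtain x where x: "x \<in> Y" "w = \<zeta> (\<alpha> * root x)" by (auto simp: T_def)
    have "poly P w = c * (1 - x)"
      using P[OF in_ball[OF x(1)]] by (simp add: x(2) power_mult_distrib \<alpha> root_pow[OF x(1)] algebra_simps)
    moreover have "norm (1 - x) < 1" using x(1) by (simp add: Y_def dist_norm)
    ultimately show "w \<in> sublevel P (norm c)" using c by (simp add: norm_mult)
  qed
  moreover have "z \<in> T" using yY root_nz[of y] by (auto simp: T_def u(1) \<alpha>_def intro!: image_eqI[of _ _ y])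
  ultimately have conn: "connected_component (sublevel P (norm c)) z w" if "w \<in> T" for w
    unfolding connected_component_def using that by blast
  show thesis
  proof (rule that[OF \<alpha>])
    fix t :: real assume t: "0 < t" "t < 1" "norm \<alpha> * t < \<rho>"
    \<comment> \<open>The ray point with parameter \<open>t\<close> corresponds to
      \<open>y = t ^ m\<close>, whose principal root is \<open>t\<close> itself.\<close>
    define s where "s = t ^ m"
    have "norm c * t ^ m = (norm \<alpha> * t) ^ m"
      using \<alpha> by (metis norm_minus_cancel norm_power power_mult_distrib)
    also have "\<dots> < \<rho> ^ m" using t \<open>m > 0\<close> by (intro power_strict_mono) auto
    finally have "t ^ m < \<rho> ^ m / norm c" using c by (simp add: field_simps)
    then have "s < \<rho> ^ m / norm c" by (simp add: s_def)
    moreover have "0 < s" "s < 1" using t \<open>m > 0\<close> by (auto simp: s_def power_less_one_iff)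
    moreover have "norm (1 - complex_of_real s) = \<bar>1 - s\<bar>"
      by (metis norm_of_real of_real_1 of_real_diff)
    ultimately have "complex_of_real s \<in> Y"
      by (simp add: Y_def dist_norm)
    moreover have "root (complex_of_real s) = of_real t"
    proof -
      have "Ln (complex_of_real s) = of_real (ln s)"
        using \<open>0 < s\<close> by (rule Ln_of_real)
      also have "ln s = of_nat m * ln t" using t by (simp add: s_def ln_realpow)
      finally have "root (complex_of_real s) = exp (complex_of_real (ln t))"
        using \<open>m > 0\<close> by (simp add: root_def)
      also have "\<dots> = of_real t" using t by (simp add: exp_of_real)
      finally show ?thesis .
    qed
    ultimately have "\<zeta> (\<alpha> * of_real t) \<in> T" unfolding T_def by (intro image_eqI[of _ _ "of_real s"]) simp_all
    then show "connected_component (sublevel P (norm c)) z (\<zeta> (\<alpha> * of_real t))" by (rule conn)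
  qed
qed

section \<open>Lower bounds for the integrals near the critical point\<close>

text \<open>Watson-type lower bound: near \<open>0\<close> the derivative of \<open>D\<close> is \<open>x ^ (n - 1) * (d + o(1))\<close> with
  \<open>d \<noteq> 0\<close>, so on a short interval the integrals of \<open>(1 - x ^ m) ^ k * deriv D x\<close> decay slower than
  any geometric sequence of ratio less than 1.\<close>

lemma watson_lower_bound:
  fixes D :: "complex \<Rightarrow> complex"
  assumes holD: "D holomorphic_on ball 0 R" and R: "R > 0"
    and nonconst: "w \<in> ball 0 R" "D w \<noteq> D 0"
  obtains t where "0 < t" "t < R" "t < 1"
    and "\<And>s. 0 < s \<Longrightarrow> s \<le> t \<Longrightarrow>
      \<exists>\<kappa>>0. \<forall>k F. F 0 = 0 \<longrightarrow>
        (\<forall>x\<in>{0..t}. (F has_field_derivative (1 - complex_of_real x ^ m) ^ k * deriv D (of_real x)) (at (of_real x))) \<longrightarrow>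
        norm (F (of_real t)) \<ge> \<kappa> * (1 - s ^ m) ^ k"
proof -
  have "\<exists>n>0. (deriv ^^ n) D 0 \<noteq> 0"
  proof (rule ccontr)
    assume "\<not> ?thesis"
    then have "(deriv ^^ n) D 0 = 0" if "n > 0" for n using that by blast
    then have "D w = D 0"
      using holomorphic_fun_eq_const_on_connected[OF holD open_ball _ _ _ nonconst(1), of 0] R by auto
    then show False using nonconst by simp
  qed
  then obtain n where n: "n > 0" "(deriv ^^ n) D 0 \<noteq> 0"
    and least: "\<And>i. 0 < i \<Longrightarrow> i < n \<Longrightarrow> (deriv ^^ i) D 0 = 0"
    using exists_least_iff[of "\<lambda>n. n > 0 \<and> (deriv ^^ n) D 0 \<noteq> 0"] by blast
  have "0 \<in> ball (0::complex) R" using R by simp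
  obtain g r where r: "0 < r" and holg: "g holomorphic_on ball 0 r"
    and fac: "\<And>w. w \<in> ball 0 r \<Longrightarrow> D w - D 0 = (w - 0) ^ n * g w"
    and g: "\<And>w. w \<in> ball 0 r \<Longrightarrow> g w \<noteq> 0"
  proof (rule holomorphic_factor_order_of_zero[OF holD open_ball \<open>0 \<in> ball 0 R\<close> n])
    show "\<And>i. 0 < i \<Longrightarrow> i < n \<Longrightarrow> (deriv ^^ i) D 0 = 0" by (rule least)
  qed (rule that)
  \<comment> \<open>Differentiating \<open>D(0) + w ^ n g(w)\<close> gives
    \<open>w ^ (n - 1) e(w)\<close>, and \<open>e(0) = n g(0)\<close> is nonzero.\<close>
  define e where "e w = of_nat n * g w + w * deriv g w" for w
  have deriv_D: "deriv D w = w ^ (n - 1) * e w" if "w \<in> ball 0 r" for w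
  proof (rule DERIV_imp_deriv)
    have "(g has_field_derivative deriv g w) (at w)"
      using holg that by (auto intro!: holomorphic_derivI)
    moreover have "((\<lambda>w. w ^ n) has_field_derivative of_nat n * w ^ (n - Suc 0)) (at w)"
      by (auto intro!: derivative_eq_intros)
    ultimately have "((\<lambda>w. D 0 + w ^ n * g w) has_field_derivative
        0 + (of_nat n * w ^ (n - Suc 0) * g w + deriv g w * w ^ n)) (at w)"
      by (intro DERIV_add DERIV_const DERIV_mult)
    moreover have "0 + (of_nat n * w ^ (n - Suc 0) * g w + deriv g w * w ^ n) = w ^ (n - 1) * e w"
      using \<open>n > 0\<close> by (cases n) (simp_all add: e_def algebra_simps)
    ultimately have "((\<lambda>w. D 0 + w ^ n * g w) has_field_derivative w ^ (n - 1) * e w) (at w)"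
      by simp
    then show "(D has_field_derivative w ^ (n - 1) * e w) (at w)"
    proof (rule has_field_derivative_transform_within_open[OF _ open_ball that])
      show "\<And>x. x \<in> ball 0 r \<Longrightarrow> D 0 + x ^ n * g x = D x"
        using fac by (metis add.commute diff_add_cancel diff_zero)
    qed
  qed
  define d where "d = e 0"
  have d: "d \<noteq> 0" using g[of 0] r \<open>n > 0\<close> by (simp add: d_def e_def)
  have "continuous_on (ball 0 r) (\<lambda>w. Re (e w / d))"
    unfolding e_def using d
    by (intro continuous_intros holomorphic_on_imp_continuous_on[OF holg]
        holomorphic_on_imp_continuous_on[OF holomorphic_deriv[OF holg]]) auto
  then have "isCont (\<lambda>w. Re (e w / d)) 0"
    using r by (simp add: continuous_on_eq_continuous_at)
  from this[unfolded isCont_def, THEN LIM_D, of "1/2"]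
  have "\<exists>\<delta>>0. \<forall>w. w \<noteq> 0 \<and> norm w < \<delta> \<longrightarrow> \<bar>Re (e w / d) - Re (e 0 / d)\<bar> < 1/2"
    by simp
  then obtain \<delta> where "\<delta> > 0"
    and "\<And>w. w \<noteq> 0 \<Longrightarrow> norm w < \<delta> \<Longrightarrow> \<bar>Re (e w / d) - Re (e 0 / d)\<bar> < 1/2"
    by blast
  moreover have "e 0 / d = 1" using d by (simp add: d_def)
  ultimately have \<delta>: "\<delta> > 0" "\<And>w. norm w < \<delta> \<Longrightarrow> \<bar>Re (e w / d) - 1\<bar> < 1/2"
    by (metis diff_self abs_zero half_gt_zero_iff one_complex.sel(1) zero_less_one)+
  \<comment> \<open>Small enough that \<open>Re (e / d)\<close> is at least 1/2 on
    \<open>[0, t]\<close>; \<open>t < 1\<close> also keeps \<open>1 - x ^ m\<close> nonnegative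
    there.\<close>
  define t where "t = Min {\<delta>, r, R, 1} / 2"
  have t: "0 < t" "t < \<delta>" "t < r" "t < R" "t < 1"
    using \<delta>(1) r R by (auto simp: t_def)
  show thesis
  proof (rule that[OF t(1,4,5)])
    fix s :: real assume s: "0 < s" "s \<le> t"
    \<comment> \<open>The factor \<open>s ^ n / (2 n)\<close> is the integral of
      \<open>x ^ (n - 1) / 2\<close> over \<open>[0, s]\<close>. There
      \<open>(1 - x ^ m) ^ k\<close> is at least \<open>(1 - s ^ m) ^ k\<close>, while the integral
      over \<open>[s, t]\<close> has nonnegative real part after division by \<open>d\<close> and is
      discarded.\<close>
    define \<kappa> where "\<kappa> = norm d * (s ^ n / (2 * real n))"
    have "\<kappa> > 0" using d s n by (simp add: \<kappa>_def)
    moreover have "norm (F (of_real t)) \<ge> \<kappa> * (1 - s ^ m) ^ k"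
      if F0: "F 0 = 0" and F: "\<forall>x\<in>{0..t}. (F has_field_derivative (1 - complex_of_real x ^ m) ^ k * deriv D (of_real x)) (at (of_real x))"
      for k and F :: "complex \<Rightarrow> complex"
    proof -
      define f where "f x = Re (F (of_real x) / d)" for x :: real
      define f' where "f' x = (1 - x ^ m) ^ k * (x ^ (n - 1) * Re (e (of_real x) / d))" for x :: real
      have Re_mult_real: "Re (of_real a * z) = a * Re z" for a z by simp
      have f: "(f has_real_derivative f' x) (at x)" if "x \<in> {0..t}" for x
      proof -
        have "deriv D (of_real x) = of_real x ^ (n - 1) * e (of_real x)"
          using that t by (intro deriv_D) auto
        then have "((\<lambda>z. F z / d) has_field_derivative
            (1 - complex_of_real x ^ m) ^ k * (of_real x ^ (n - 1) * e (of_real x)) / d) (at (of_real x))"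
          using F that by (metis DERIV_cdivide)
        then have "((\<lambda>x. Re (F (of_real x) / d)) has_vector_derivative
            Re ((1 - complex_of_real x ^ m) ^ k * (of_real x ^ (n - 1) * e (of_real x)) / d)) (at x)"
          by (intro bounded_linear.has_vector_derivative[OF bounded_linear_Re] has_vector_derivative_real_field)
        moreover have "(1 - complex_of_real x ^ m) ^ k * (of_real x ^ (n - 1) * e (of_real x)) / d =
            of_real ((1 - x ^ m) ^ k * x ^ (n - 1)) * (e (of_real x) / d)"
          by simp
        then have "Re ((1 - complex_of_real x ^ m) ^ k * (of_real x ^ (n - 1) * e (of_real x)) / d) = f' x"
          by (simp only: f'_def Re_mult_real mult.assoc)
        ultimately show ?thesis
          by (simp only: f_def[abs_def] has_real_derivative_iff_has_vector_derivative)
      qed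
      have e_ge: "Re (e (of_real x) / d) \<ge> 1/2" if "x \<in> {0..t}" for x
      proof -
        have "\<bar>Re (e (of_real x) / d) - 1\<bar> < 1/2" using that t by (intro \<delta>(2)) simp
        then show ?thesis by linarith
      qed
      have x_pow: "0 \<le> 1 - x ^ m" if "x \<in> {0..t}" for x
        using that t power_le_one[of x m] by simp
      have "f s \<le> f t"
      proof (rule DERIV_nonneg_imp_nondecreasing[OF s(2)])
        fix x assume "s \<le> x" "x \<le> t"
        then have x: "x \<in> {0..t}" using s by simp
        then have "f' x \<ge> 0"
          using e_ge[OF x] x_pow[OF x] unfolding f'_def by (intro mult_nonneg_nonneg zero_le_power) auto
        then show "\<exists>y. DERIV f x :> y \<and> y \<ge> 0" using f[OF x] by blast
      qed
      define h where "h x = f x - (1 - s ^ m) ^ k * (x ^ n / (2 * real n))" for x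
      have "h 0 \<le> h s"
      proof (rule DERIV_nonneg_imp_nondecreasing[of 0 s h])
        fix x assume "0 \<le> x" "x \<le> s"
        then have x: "x \<in> {0..t}" using s by simp
        have "(h has_real_derivative f' x - (1 - s ^ m) ^ k * (x ^ (n - 1) / 2)) (at x)"
          unfolding h_def[abs_def]
        proof (rule DERIV_diff[OF f[OF x] DERIV_cmult])
          have "((\<lambda>x. x ^ n / (2 * real n)) has_real_derivative real n * x ^ (n - 1) / (2 * real n)) (at x)"
            using DERIV_cdivide[OF DERIV_pow[of n x UNIV], of "2 * real n"] by simp
          then show "((\<lambda>x. x ^ n / (2 * real n)) has_real_derivative x ^ (n - 1) / 2) (at x)"
            using n by simp
        qed
        moreover have "(1 - s ^ m) ^ k * (x ^ (n - 1) * (1/2)) \<le> f' x"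
          unfolding f'_def
        proof (rule mult_mono)
          have "x ^ m \<le> s ^ m" using \<open>0 \<le> x\<close> \<open>x \<le> s\<close> by (intro power_mono)
          then show "(1 - s ^ m) ^ k \<le> (1 - x ^ m) ^ k"
            using x_pow[of s] s by (intro power_mono) auto
          show "0 \<le> (1 - x ^ m) ^ k" using x_pow[OF x] by simp
          show "x ^ (n - 1) * (1/2) \<le> x ^ (n - 1) * Re (e (of_real x) / d)"
            by (rule mult_left_mono[OF e_ge[OF x]]) (use \<open>0 \<le> x\<close> in simp)
        qed (use \<open>0 \<le> x\<close> in simp)
        then have "f' x - (1 - s ^ m) ^ k * (x ^ (n - 1) / 2) \<ge> 0" by simp
        ultimately show "\<exists>y. DERIV h x :> y \<and> y \<ge> 0" by blast
      qed (use s in simp)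
      moreover have "h 0 = 0" using n by (simp add: h_def f_def F0)
      ultimately have "(1 - s ^ m) ^ k * (s ^ n / (2 * real n)) \<le> f t"
        using \<open>f s \<le> f t\<close> by (simp add: h_def)
      also have "f t \<le> norm (F (of_real t)) / norm d"
        using complex_Re_le_cmod[of "F (of_real t) / d"] unfolding f_def norm_divide .
      finally show ?thesis using d by (simp add: \<kappa>_def field_simps)
    qed
    ultimately show "\<exists>\<kappa>>0. \<forall>k F. F 0 = 0 \<longrightarrow>
        (\<forall>x\<in>{0..t}. (F has_field_derivative (1 - complex_of_real x ^ m) ^ k * deriv D (of_real x)) (at (of_real x))) \<longrightarrow>
        norm (F (of_real t)) \<ge> \<kappa> * (1 - s ^ m) ^ k"
      by (intro exI[of _ \<kappa>] conjI allI impI)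
  qed
qed

section \<open>Critical points at the pass level and coincidences of \<open>P\<close> and
  \<open>Q\<close>\<close>

lemma open_meets_closure:
  assumes "v \<in> closure S" "open N" "v \<in> N"
  obtains x where "x \<in> S" "x \<in> N"
  using assms open_Int_closure_eq_empty[of N S] by blast

lemma open_coordinate_image:
  assumes "\<zeta> holomorphic_on ball 0 \<rho>" "inj_on \<zeta> (ball 0 \<rho>)" "\<rho> > 0"
  shows "open (\<zeta> ` ball 0 \<rho>)" "\<zeta> 0 \<in> \<zeta> ` ball 0 \<rho>"
  using open_mapping_thm3[OF assms(1) open_ball assms(2)] assms(3) by auto

text \<open>Chain rule: the derivative of \<open>c + u ^ m\<close> vanishes at 0, whereas that of
  the injective \<open>\<zeta>\<close> does not.\<close>

lemma critical_point_if_ramified: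
  assumes hol: "\<zeta> holomorphic_on ball 0 \<rho>" and inj: "inj_on \<zeta> (ball 0 \<rho>)" and "\<rho> > 0" "m \<ge> 2"
    and P: "\<And>u. u \<in> ball 0 \<rho> \<Longrightarrow> poly P (\<zeta> u) = c + u ^ m"
  shows "critical_point P (\<zeta> 0)"
proof -
  have 0: "0 \<in> ball (0::complex) \<rho>" using \<open>\<rho> > 0\<close> by simp
  have "deriv \<zeta> 0 \<noteq> 0" by (rule holomorphic_injective_imp_regular[OF hol open_ball inj 0])
  have "(\<zeta> has_field_derivative deriv \<zeta> 0) (at 0)"
    by (rule holomorphic_derivI[OF hol open_ball 0])
  then have 1: "((\<lambda>u. poly P (\<zeta> u)) has_field_derivative deriv \<zeta> 0 * poly (pderiv P) (\<zeta> 0)) (at 0)"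
    by (rule has_field_derivative_poly)
  have "((\<lambda>u. c + u ^ m) has_field_derivative 0 + of_nat m * 0 ^ (m - Suc 0)) (at (0::complex))"
    by (auto intro!: derivative_eq_intros)
  then have "((\<lambda>u. c + u ^ m) has_field_derivative 0) (at (0::complex))"
    using \<open>m \<ge> 2\<close> by (simp add: power_0_left)
  then have "((\<lambda>u. poly P (\<zeta> u)) has_field_derivative 0) (at 0)"
    by (rule has_field_derivative_transform_within_open[OF _ open_ball 0]) (simp add: P)
  then have "deriv \<zeta> 0 * poly (pderiv P) (\<zeta> 0) = 0" using 1 DERIV_unique by blast
  then show ?thesis using \<open>deriv \<zeta> 0 \<noteq> 0\<close> by (simp add: critical_point_def)
qed

text \<open>Near the pass point \<open>v\<close> there are points of the component of
  \<open>a\<close> and points outside it. Their sectors contain different rays, hence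
  \<open>- P(v)\<close> has two distinct \<open>m\<close>-th roots and \<open>P\<close> is ramified
  at \<open>v\<close>.\<close>

lemma mountain_pass_critical_point:
  assumes deg: "degree P > 0" and a: "norm (poly P a) < M" and b: "norm (poly P b) < M"
    and sep: "\<not> connected_component (sublevel P M) a b"
    and conn: "\<And>r. r > M \<Longrightarrow> connected_component (sublevel P r) a b"
  obtains v where "norm (poly P v) = M" "critical_point P v"
    "v \<in> closure (connected_component_set (sublevel P M) a)"
proof -
  obtain v where v: "norm (poly P v) = M" "v \<in> closure (connected_component_set (sublevel P M) a)"
    "v \<in> closure (sublevel P M - connected_component_set (sublevel P M) a)"
    using mountain_pass[OF assms] by blast
  obtain m \<rho> \<zeta> where m: "m > 0" and \<rho>: "\<rho> > 0" and \<zeta>: "\<zeta> holomorphic_on ball 0 \<rho>" "inj_on \<zeta> (ball 0 \<rho>)"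
    "\<zeta> 0 = v" and P: "\<And>u. u \<in> ball 0 \<rho> \<Longrightarrow> poly P (\<zeta> u) = poly P v + u ^ m"
    using local_coordinate[OF deg] by blast
  note N = open_coordinate_image[OF \<zeta>(1,2) \<rho>, unfolded \<zeta>(3)]
  obtain x where x: "x \<in> \<zeta> ` ball 0 \<rho>" "connected_component (sublevel P M) a x"
    using open_meets_closure[OF v(2) N] by blast
  obtain y where y: "y \<in> \<zeta> ` ball 0 \<rho>" "norm (poly P y) < M" "\<not> connected_component (sublevel P M) a y"
    using open_meets_closure[OF v(3) N] by blast
  have "norm (poly P x) < M" using connected_component_in[OF x(2)] by simp
  then obtain \<alpha> where \<alpha>: "\<alpha> ^ m = - poly P v" and ray_x: "\<And>t. 0 < t \<Longrightarrow> t < 1 \<Longrightarrow> norm \<alpha> * t < \<rho> \<Longrightarrow>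
      connected_component (sublevel P M) x (\<zeta> (\<alpha> * of_real t))"
    using sector_ray[OF m \<zeta>(1) P x(1)] v(1) by metis
  obtain \<beta> where \<beta>: "\<beta> ^ m = - poly P v" and ray_y: "\<And>t. 0 < t \<Longrightarrow> t < 1 \<Longrightarrow> norm \<beta> * t < \<rho> \<Longrightarrow>
      connected_component (sublevel P M) y (\<zeta> (\<beta> * of_real t))"
    using sector_ray[OF m \<zeta>(1) P y(1)] v(1) y(2) by metis
  have "\<alpha> \<noteq> \<beta>"
  proof
    assume "\<alpha> = \<beta>"
    \<comment> \<open>A parameter for which the common ray point lies inside the coordinate disc, so
      that it would connect \<open>x\<close> and \<open>y\<close>.\<close>
    define t where "t = min (1/2) (\<rho> / (norm \<alpha> + 1))"
    have "t \<le> \<rho> / (norm \<alpha> + 1)" by (simp add: t_def)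
    then have "(norm \<alpha> + 1) * t \<le> \<rho>" by (simp add: field_simps add_pos_nonneg)
    moreover have t: "0 < t" "t < 1" using \<rho> by (auto simp: t_def add_nonneg_pos)
    ultimately have "norm \<alpha> * t < \<rho>" by (simp add: algebra_simps)
    then have "connected_component (sublevel P M) x y"
      using ray_x[of t] ray_y[of t] t \<open>\<alpha> = \<beta>\<close> by (meson connected_component_sym connected_component_trans)
    then show False using x(2) y(3) by (meson connected_component_trans)
  qed
  then have "m \<noteq> 1" using \<alpha> \<beta> by auto
  then have "critical_point P v"
    using critical_point_if_ramified[OF \<zeta>(1,2) \<rho> _ P] m \<zeta>(3) by simp
  then show thesis using that v by blast
qed

text \<open>The asymptotic argument for a polynomial already shifted to the chosen centre. The level
  \<open>r\<^sub>0\<close> bounds the pass level \<open>M\<close> from below, so critical points are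
  only compared at levels where \<open>uniq\<close> speaks.\<close>

lemma infinite_coincidences_if_centered:
  fixes P Q :: "complex poly" and r\<^sub>0 :: real
  assumes deg: "degree P > 0"
    and a: "norm (poly P a) < r\<^sub>0" and b: "norm (poly P b) < r\<^sub>0"
    and sep: "\<not> connected_component (sublevel P r\<^sub>0) a b"
    and uniq: "\<And>v w. critical_point P v \<Longrightarrow> critical_point P w \<Longrightarrow> norm (poly P v) = norm (poly P w) \<Longrightarrow>
      norm (poly P v) \<ge> r\<^sub>0 \<Longrightarrow> v = w"
    and mom: "\<And>k G. pderiv G = P ^ k * pderiv Q \<Longrightarrow> poly G a = poly G b"
  shows "infinite {z. \<exists>w. w \<noteq> z \<and> poly P w = poly P z \<and> poly Q w = poly Q z}"
proof -
  \<comment> \<open>The levels at which \<open>a\<close> and \<open>b\<close> are connected. Their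
    infimum \<open>M\<close> is not attained, since a connection at \<open>M\<close> could be pushed
    to a lower level.\<close>
  define S where "S = {r. connected_component (sublevel P r) a b}"
  define M where "M = Inf S"
  have lower: "r\<^sub>0 \<le> r" if "r \<in> S" for r
    using that sep sublevel_component_mono[of P r a b r\<^sub>0] by (force simp: S_def)
  then have bdd: "bdd_below S" by (rule bdd_belowI)
  have "compact (poly P ` closed_segment a b)"
    by (intro compact_continuous_image continuous_intros compact_segment)
  then obtain R where "\<And>z. z \<in> closed_segment a b \<Longrightarrow> norm (poly P z) \<le> R"
    by (meson bounded_iff compact_imp_bounded imageI)
  then have "closed_segment a b \<subseteq> sublevel P (R + 1)" by force
  then have "R + 1 \<in> S"
    unfolding S_def mem_Collect_eq connected_component_def
    by (intro exI[of _ "closed_segment a b"]) (auto simp: connected_segment)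
  then have "S \<noteq> {}" by blast
  have M_ge: "r\<^sub>0 \<le> M" unfolding M_def using \<open>S \<noteq> {}\<close> lower by (rule cInf_greatest)
  have sepM: "\<not> connected_component (sublevel P M) a b"
  proof
    assume "connected_component (sublevel P M) a b"
    then obtain r where "r < M" "r \<in> S" using sublevel_component_shrink by (metis S_def mem_Collect_eq)
    then show False using cInf_lower[OF _ bdd, of r] by (simp add: M_def)
  qed
  have connM: "connected_component (sublevel P r) a b" if r: "r > M" for r
  proof -
    obtain s where "s \<in> S" "s < r"
      using cInf_lessD[OF \<open>S \<noteq> {}\<close> r[unfolded M_def]] by blast
    then show ?thesis using sublevel_component_mono[of P s a b r] by (simp add: S_def)
  qed
  have aM: "norm (poly P a) < M" and bM: "norm (poly P b) < M" using a b M_ge by auto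
  then have M: "M > 0" by (smt (verit) norm_ge_zero)
  obtain v where v: "norm (poly P v) = M" "critical_point P v"
    "v \<in> closure (connected_component_set (sublevel P M) a)"
    using mountain_pass_critical_point[OF deg aM bM sepM connM] by blast
  \<comment> \<open>The point \<open>v\<close> touches the component of \<open>a\<close> and some
    other component, not necessarily that of \<open>b\<close>. The same argument from
    \<open>b\<close> gives a critical point on the same level, which \<open>uniq\<close> identifies
    with \<open>v\<close>.\<close>
  have sepM': "\<not> connected_component (sublevel P M) b a"
    using sepM connected_component_sym by metis
  have connM': "connected_component (sublevel P r) b a" if "r > M" for r
    using connM[OF that] connected_component_sym by metis
  obtain v' where v': "norm (poly P v') = M" "critical_point P v'"
    "v' \<in> closure (connected_component_set (sublevel P M) b)"
    using mountain_pass_critical_point[OF deg bM aM sepM' connM'] by blast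
  have "v' = v" using uniq v v' M_ge by simp
  define c where "c = poly P v"
  have c: "norm c = M" "c \<noteq> 0" using v(1) M by (auto simp: c_def)
  obtain m \<rho> \<zeta> where m: "m > 0" and \<rho>: "\<rho> > 0" and \<zeta>: "\<zeta> holomorphic_on ball 0 \<rho>" "inj_on \<zeta> (ball 0 \<rho>)"
    "\<zeta> 0 = v" and P: "\<And>u. u \<in> ball 0 \<rho> \<Longrightarrow> poly P (\<zeta> u) = c + u ^ m"
    using local_coordinate[OF deg] unfolding c_def by blast
  note N = open_coordinate_image[OF \<zeta>(1,2) \<rho>, unfolded \<zeta>(3)]
  obtain x where x: "x \<in> \<zeta> ` ball 0 \<rho>" "connected_component (sublevel P M) a x"
    using open_meets_closure[OF v(3) N] by blast
  obtain y where y: "y \<in> \<zeta> ` ball 0 \<rho>" "connected_component (sublevel P M) b y"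
    using open_meets_closure[OF v'(3)[unfolded \<open>v' = v\<close>] N] by blast
  have xy: "norm (poly P x) < M" "norm (poly P y) < M"
    using connected_component_in[OF x(2)] connected_component_in[OF y(2)] by simp_all
  obtain \<alpha> where \<alpha>: "\<alpha> ^ m = - c" and "\<And>t. 0 < t \<Longrightarrow> t < 1 \<Longrightarrow> norm \<alpha> * t < \<rho> \<Longrightarrow>
      connected_component (sublevel P M) x (\<zeta> (\<alpha> * of_real t))"
    using sector_ray[OF m \<zeta>(1) P x(1)] c(1) xy by metis
  then have ray_a: "\<And>t. 0 < t \<Longrightarrow> t < 1 \<Longrightarrow> norm \<alpha> * t < \<rho> \<Longrightarrow>
      connected_component (sublevel P M) a (\<zeta> (\<alpha> * of_real t))"
    using x(2) connected_component_trans by metis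
  obtain \<beta> where \<beta>: "\<beta> ^ m = - c" and "\<And>t. 0 < t \<Longrightarrow> t < 1 \<Longrightarrow> norm \<beta> * t < \<rho> \<Longrightarrow>
      connected_component (sublevel P M) y (\<zeta> (\<beta> * of_real t))"
    using sector_ray[OF m \<zeta>(1) P y(1)] c(1) xy by metis
  then have ray_b: "\<And>t. 0 < t \<Longrightarrow> t < 1 \<Longrightarrow> norm \<beta> * t < \<rho> \<Longrightarrow>
      connected_component (sublevel P M) b (\<zeta> (\<beta> * of_real t))"
    using y(2) connected_component_trans by metis
  have nz: "\<alpha> \<noteq> 0" "\<beta> \<noteq> 0" using \<alpha> \<beta> c(2) m by (auto simp: power_0_left)
  have "norm \<alpha> ^ m = norm \<beta> ^ m" using \<alpha> \<beta> by (metis norm_power)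
  then have norm_eq: "norm \<beta> = norm \<alpha>" using m by (metis norm_ge_zero power_eq_imp_eq_base)
  \<comment> \<open>Radius for the rescaled variable \<open>w\<close>, with
    \<open>u = \<alpha> w\<close> on one ray and \<open>u = \<beta> w\<close> on the other; on both,
    \<open>P\<close> equals \<open>c (1 - w ^ m)\<close>.\<close>
  define R where "R = \<rho> / norm \<alpha>"
  have R: "R > 0" using \<rho> nz by (simp add: R_def)
  have in_ball: "\<alpha> * w \<in> ball 0 \<rho>" "\<beta> * w \<in> ball 0 \<rho>" if "w \<in> ball 0 R" for w
    using that nz by (simp_all add: R_def norm_mult norm_eq field_simps)
  have ray: "connected_component (sublevel P M) a (\<zeta> (\<alpha> * of_real t))"
    "connected_component (sublevel P M) b (\<zeta> (\<beta> * of_real t))" if "0 < t" "t < 1" "t < R" for t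
    using that nz by (intro ray_a ray_b; simp add: R_def norm_eq field_simps)+
  have "\<alpha> \<noteq> \<beta>"
  proof
    assume "\<alpha> = \<beta>"
    define t where "t = min R 1 / 2"
    have "0 < t" "t < 1" "t < R" using R by (auto simp: t_def)
    from ray[OF this] sepM show False
      unfolding \<open>\<alpha> = \<beta>\<close> by (meson connected_component_sym connected_component_trans)
  qed
  have P_ray: "poly P (\<zeta> (\<alpha> * w)) = c * (1 - w ^ m)" "poly P (\<zeta> (\<beta> * w)) = c * (1 - w ^ m)"
    if "w \<in> ball 0 R" for w
    using in_ball[OF that] by (simp_all add: P power_mult_distrib \<alpha> \<beta> algebra_simps)
  \<comment> \<open>The difference of the branches of \<open>Q\<close> over the two sectors, to be
    shown identically zero.\<close>
  define D where "D w = poly Q (\<zeta> (\<alpha> * w)) - poly Q (\<zeta> (\<beta> * w))" for w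
  have deriv_\<zeta>: "((\<lambda>w. \<zeta> (\<gamma> * w)) has_field_derivative deriv \<zeta> (\<gamma> * w) * \<gamma>) (at w)"
    if "\<gamma> * w \<in> ball 0 \<rho>" for \<gamma> w
  proof -
    have "(\<zeta> has_field_derivative deriv \<zeta> (\<gamma> * w)) (at (\<gamma> * w))"
      by (rule holomorphic_derivI[OF \<zeta>(1) open_ball that])
    moreover have "((\<lambda>w. \<gamma> * w) has_field_derivative \<gamma>) (at w)"
      by (auto intro!: derivative_eq_intros)
    ultimately show ?thesis by (rule DERIV_chain2)
  qed
  have deriv_pair: "((\<lambda>w. poly F (\<zeta> (\<alpha> * w)) - poly F (\<zeta> (\<beta> * w))) has_field_derivative
      deriv \<zeta> (\<alpha> * w) * \<alpha> * poly (pderiv F) (\<zeta> (\<alpha> * w)) - deriv \<zeta> (\<beta> * w) * \<beta> * poly (pderiv F) (\<zeta> (\<beta> * w))) (at w)"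
    if "w \<in> ball 0 R" for F w
    by (intro DERIV_diff has_field_derivative_poly deriv_\<zeta> in_ball[OF that])
  have holD: "D holomorphic_on ball 0 R"
    unfolding holomorphic_on_open[OF open_ball] D_def using deriv_pair by blast
  have D0: "D 0 = 0" by (simp add: D_def)
  have D_zero: "D w = 0" if w: "w \<in> ball 0 R" for w
  proof (rule ccontr)
    assume "D w \<noteq> 0"
    then have "D w \<noteq> D 0" by (simp add: D0)
    obtain t where t: "0 < t" "t < R" "t < 1"
      and watson: "\<And>s. 0 < s \<Longrightarrow> s \<le> t \<Longrightarrow>
      \<exists>\<kappa>>0. \<forall>k F. F 0 = 0 \<longrightarrow>
        (\<forall>x\<in>{0..t}. (F has_field_derivative (1 - complex_of_real x ^ m) ^ k * deriv D (of_real x)) (at (of_real x))) \<longrightarrow>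
        norm (F (of_real t)) \<ge> \<kappa> * (1 - s ^ m) ^ k"
      by (rule watson_lower_bound[OF holD R w \<open>D w \<noteq> D 0\<close>, of m], rule that)
    let ?x = "\<zeta> (\<alpha> * of_real t)" and ?y = "\<zeta> (\<beta> * of_real t)"
    obtain r1 where r1: "r1 < M" "connected_component (sublevel P r1) a ?x"
      using sublevel_component_shrink[OF ray(1)[OF t(1,3,2)]] by blast
    obtain r2 where r2: "r2 < M" "connected_component (sublevel P r2) b ?y"
      using sublevel_component_shrink[OF ray(2)[OF t(1,3,2)]] by blast
    define r where "r = max r1 r2"
    have r: "r < M" "connected_component (sublevel P r) a ?x" "connected_component (sublevel P r) b ?y"
      using r1 r2 sublevel_component_mono[of P _ _ _ r] by (auto simp: r_def)
    have "norm (poly P a) < r" using connected_component_in[OF r(2)] by simp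
    then have "r > 0" using norm_ge_zero le_less_trans by blast
    have "\<forall>k. \<exists>G. pderiv G = P ^ k * pderiv Q" using pderiv_surj by blast
    then obtain G where G: "\<And>k. pderiv (G k) = P ^ k * pderiv Q" by metis
    obtain C1 where C1: "\<And>k. norm (poly (G k) a - poly (G k) ?x) \<le> C1 * r ^ k"
      using moment_difference_bound[OF r(2) G] by blast
    obtain C2 where C2: "\<And>k. norm (poly (G k) b - poly (G k) ?y) \<le> C2 * r ^ k"
      using moment_difference_bound[OF r(3) G] by blast
    have upper: "norm (poly (G k) ?x - poly (G k) ?y) \<le> (C1 + C2) * r ^ k" for k
    proof -
      have "norm (poly (G k) ?x - poly (G k) ?y) =
          norm ((poly (G k) b - poly (G k) ?y) - (poly (G k) a - poly (G k) ?x))"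
        using mom[OF G, of k] by simp
      also have "\<dots> \<le> C2 * r ^ k + C1 * r ^ k"
        by (intro order_trans[OF norm_triangle_ineq4] add_mono C1 C2)
      finally show ?thesis by (simp add: algebra_simps)
    qed
    \<comment> \<open>Chosen so that \<open>s ^ m \<le> s < 2 s \<le> 1 - r / M\<close>: the ratio
      \<open>q\<close> of the lower bound then exceeds the ratio \<open>r / M\<close> of the upper
      bound.\<close>
    define s where "s = min t ((1 - r / M) / 2)"
    have "r / M < 1" using r(1) M by simp
    then have s: "0 < s" "s \<le> t" using t by (simp_all add: s_def)
    have s_le: "s \<le> (1 - r / M) / 2" unfolding s_def by (rule min.cobounded2)
    define q where "q = 1 - s ^ m"
    have "s ^ m \<le> s ^ 1" using s t m by (intro power_decreasing) auto
    also have "\<dots> < 2 * s" using s by simp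
    also have "\<dots> \<le> 1 - r / M" using s_le by simp
    finally have q: "r / M < q" by (simp add: q_def)
    have "r / M > 0" using \<open>r > 0\<close> M by simp
    obtain \<kappa> where \<kappa>: "\<kappa> > 0" and low: "\<forall>k F. F 0 = 0 \<longrightarrow>
        (\<forall>x\<in>{0..t}. (F has_field_derivative (1 - complex_of_real x ^ m) ^ k * deriv D (of_real x)) (at (of_real x))) \<longrightarrow>
        norm (F (of_real t)) \<ge> \<kappa> * (1 - s ^ m) ^ k"
      using watson[OF s(1,2)] by (elim exE conjE) (rule that)
    have lower: "norm (F (of_real t)) \<ge> \<kappa> * q ^ k" if "F 0 = 0"
        "\<And>x. x \<in> {0..t} \<Longrightarrow> (F has_field_derivative (1 - complex_of_real x ^ m) ^ k * deriv D (of_real x)) (at (of_real x))" for k F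
      unfolding q_def by (rule low[rule_format]) (use that in auto)
    have bound: "\<kappa> * q ^ k \<le> (C1 + C2) * (r / M) ^ k" for k
    proof -
      \<comment> \<open>Along the rays \<open>P ^ k\<close> is \<open>c ^ k (1 - w ^ m) ^ k\<close>;
        dividing by \<open>c ^ k\<close> gives exactly the integrand of the Watson bound.\<close>
      define F where "F w = (poly (G k) (\<zeta> (\<alpha> * w)) - poly (G k) (\<zeta> (\<beta> * w))) / c ^ k" for w
      have "norm (F (of_real t)) \<ge> \<kappa> * q ^ k"
      proof (rule lower)
        show "F 0 = 0" by (simp add: F_def)
        fix x assume x: "x \<in> {0..t}"
        then have xR: "complex_of_real x \<in> ball 0 R" using t(2) by simp
        have "deriv D (of_real x) = deriv \<zeta> (\<alpha> * of_real x) * \<alpha> * poly (pderiv Q) (\<zeta> (\<alpha> * of_real x))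
            - deriv \<zeta> (\<beta> * of_real x) * \<beta> * poly (pderiv Q) (\<zeta> (\<beta> * of_real x))"
          unfolding D_def[abs_def] by (rule DERIV_imp_deriv[OF deriv_pair[OF xR]])
        moreover have "(F has_field_derivative
            (deriv \<zeta> (\<alpha> * of_real x) * \<alpha> * poly (pderiv (G k)) (\<zeta> (\<alpha> * of_real x))
            - deriv \<zeta> (\<beta> * of_real x) * \<beta> * poly (pderiv (G k)) (\<zeta> (\<beta> * of_real x))) / c ^ k) (at (of_real x))"
          unfolding F_def[abs_def] by (rule DERIV_cdivide[OF deriv_pair[OF xR]])
        moreover have "(deriv \<zeta> (\<alpha> * of_real x) * \<alpha> * poly (pderiv (G k)) (\<zeta> (\<alpha> * of_real x))
            - deriv \<zeta> (\<beta> * of_real x) * \<beta> * poly (pderiv (G k)) (\<zeta> (\<beta> * of_real x))) / c ^ k =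
            (1 - complex_of_real x ^ m) ^ k *
            (deriv \<zeta> (\<alpha> * of_real x) * \<alpha> * poly (pderiv Q) (\<zeta> (\<alpha> * of_real x))
            - deriv \<zeta> (\<beta> * of_real x) * \<beta> * poly (pderiv Q) (\<zeta> (\<beta> * of_real x)))"
        proof -
          have "(A * (c ^ k * y * p) - B * (c ^ k * y * q)) / c ^ k = y * (A * p - B * q)" for A B y p q
            using c(2) by (simp add: field_simps)
          then show ?thesis by (simp only: G poly_mult poly_power P_ray[OF xR] power_mult_distrib)
        qed
        ultimately show "(F has_field_derivative (1 - complex_of_real x ^ m) ^ k * deriv D (of_real x)) (at (of_real x))"
          by simp
      qed
      also have "norm (F (of_real t)) = norm (poly (G k) ?x - poly (G k) ?y) / M ^ k"
        by (simp add: F_def norm_divide norm_power c(1))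
      also have "\<dots> \<le> (C1 + C2) * r ^ k / M ^ k"
        using upper[of k] M by (intro divide_right_mono) auto
      finally show ?thesis by (simp add: power_divide)
    qed
    \<comment> \<open>A positive majorant of \<open>C1 + C2\<close>, allowing division by
      it.\<close>
    define C where "C = \<bar>C1 + C2\<bar> + 1"
    have "C > 0" by (simp add: C_def)
    have q0: "q > 0" using q \<open>r / M > 0\<close> by linarith
    have "\<kappa> / C > 0" "r / M / q < 1"
      using \<kappa> \<open>C > 0\<close> q q0 by (simp_all only: divide_pos_pos divide_less_eq_1_pos)
    then obtain k where k: "(r / M / q) ^ k < \<kappa> / C"
      using real_arch_pow_inv by blast
    have "(C1 + C2) * (r / M) ^ k \<le> C * (r / M) ^ k"
      using \<open>r / M > 0\<close> by (intro mult_right_mono) (auto simp: C_def)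
    with bound[of k] have "\<kappa> * q ^ k \<le> C * (r / M) ^ k" by linarith
    then have "\<kappa> / C \<le> (r / M) ^ k / q ^ k"
      using \<open>C > 0\<close> q0 by (simp only: pos_divide_le_eq pos_le_divide_eq zero_less_power mult.commute times_divide_eq_left times_divide_eq_right)
    with k show False by (simp add: power_divide power_mult_distrib)
  qed
  \<comment> \<open>Points on the first ray; the partner of \<open>\<zeta> (\<alpha> * t)\<close> is
    \<open>\<zeta> (\<beta> * t)\<close>, distinct from it because \<open>\<zeta>\<close> is
    injective.\<close>
  define Z where "Z = (\<lambda>t. \<zeta> (\<alpha> * complex_of_real t)) ` {0<..<R}"
  have "inj_on (\<lambda>t. \<zeta> (\<alpha> * complex_of_real t)) {0<..<R}"
  proof (rule inj_onI)
    fix s t assume st: "s \<in> {0<..<R}" "t \<in> {0<..<R}" "\<zeta> (\<alpha> * complex_of_real s) = \<zeta> (\<alpha> * complex_of_real t)"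
    then have "\<alpha> * complex_of_real s = \<alpha> * complex_of_real t"
      by (intro inj_onD[OF \<zeta>(2) st(3) in_ball(1) in_ball(1)]) auto
    then show "s = t" using nz by simp
  qed
  then have "infinite Z" unfolding Z_def using R by (simp add: finite_image_iff infinite_Ioo)
  moreover have "Z \<subseteq> {z. \<exists>w. w \<noteq> z \<and> poly P w = poly P z \<and> poly Q w = poly Q z}"
  proof
    fix z assume "z \<in> Z"
    then obtain t where t: "0 < t" "t < R" and z: "z = \<zeta> (\<alpha> * of_real t)" by (auto simp: Z_def)
    then have tR: "complex_of_real t \<in> ball 0 R" by simp
    have "\<zeta> (\<beta> * of_real t) \<noteq> z"
    proof
      assume "\<zeta> (\<beta> * of_real t) = z"
      then have "\<beta> * of_real t = \<alpha> * of_real t"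
        unfolding z by (rule inj_onD[OF \<zeta>(2) _ in_ball(2,1)[OF tR]])
      then show False using t \<open>\<alpha> \<noteq> \<beta>\<close> by simp
    qed
    moreover have "poly P (\<zeta> (\<beta> * of_real t)) = poly P z" unfolding z by (simp only: P_ray[OF tR])
    moreover have "poly Q (\<zeta> (\<beta> * of_real t)) = poly Q z"
      using D_zero[OF tR] unfolding z D_def by simp
    ultimately show "z \<in> {z. \<exists>w. w \<noteq> z \<and> poly P w = poly P z \<and> poly Q w = poly Q z}" by blast
  qed
  ultimately show ?thesis using finite_subset by blast
qed

subsection \<open>Reduction to a generic centre\<close>

text \<open>Squaring both distances cancels the quadratic terms and leaves the equation of a
  hyperplane.\<close>

lemma negligible_bisector:
  fixes u v :: complex
  assumes "u \<noteq> v"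
  shows "negligible {x. dist x u = dist x v}"
proof (rule negligible_subset[OF negligible_hyperplane])
  show "2 *\<^sub>R (u - v) \<noteq> 0 \<or> u \<bullet> u - v \<bullet> v \<noteq> 0" using assms by simp
  show "{x. dist x u = dist x v} \<subseteq> {x. 2 *\<^sub>R (u - v) \<bullet> x = u \<bullet> u - v \<bullet> v}"
    by (auto simp: dist_norm norm_eq algebra_simps inner_commute)
qed

text \<open>The centre is moved slightly off \<open>P(a)\<close> so that distinct critical values
  have distinct distances from it. Critical points on one high level then share their critical
  value, and \<open>uniq\<close> makes them equal.\<close>

lemma infinite_coincidences:
  fixes P Q :: "complex poly"
  assumes deg: "degree P > 0" and "a \<noteq> b" and ab: "poly P a = poly P b"
    and uniq: "\<And>v w. critical_point P v \<Longrightarrow> critical_point P w \<Longrightarrow> poly P v = poly P w \<Longrightarrow>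
      poly P v \<noteq> poly P a \<Longrightarrow> v = w"
    and mom: "\<And>R G. pderiv G = (R \<circ>\<^sub>p P) * pderiv Q \<Longrightarrow> poly G a = poly G b"
  shows "infinite {z. \<exists>w. w \<noteq> z \<and> poly P w = poly P z \<and> poly Q w = poly Q z}"
proof -
  have P_const: "P - [:c:] \<noteq> 0" for c
    using deg by (metis degree_pCons_0 less_irrefl right_minus_eq)
  have "finite {z. poly (P - [:poly P a:]) z = 0}" by (rule poly_roots_finite[OF P_const])
  \<comment> \<open>A circle about \<open>a\<close> that separates it from \<open>b\<close> and
    avoids the finitely many solutions of \<open>P(z) = P(a)\<close>.\<close>
  then have "\<not> {0<..<dist a b} \<subseteq> dist a ` {z. poly (P - [:poly P a:]) z = 0}"
    using infinite_Ioo[of 0 "dist a b"] \<open>a \<noteq> b\<close> by (meson finite_imageI finite_subset zero_less_dist_iff)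
  then obtain \<delta> where "\<delta> \<in> {0<..<dist a b}" "\<delta> \<notin> dist a ` {z. poly (P - [:poly P a:]) z = 0}"
    by blast
  then have \<delta>: "0 < \<delta>" "\<delta> < dist a b" "\<delta> \<notin> dist a ` {z. poly (P - [:poly P a:]) z = 0}"
    by simp_all
  have off: "poly P z \<noteq> poly P a" if "z \<in> sphere a \<delta>" for z
    using \<delta>(3) that by (auto simp: image_iff)
  have "sphere a \<delta> \<noteq> {}" using \<delta>(1) by simp
  moreover have "continuous_on (sphere a \<delta>) (\<lambda>z. norm (poly P z - poly P a))"
    by (intro continuous_intros)
  ultimately obtain z0 where z0: "z0 \<in> sphere a \<delta>"
    "\<And>z. z \<in> sphere a \<delta> \<Longrightarrow> norm (poly P z0 - poly P a) \<le> norm (poly P z - poly P a)"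
    using continuous_attains_inf[OF compact_sphere] by meson
  \<comment> \<open>Every connected set joining \<open>a\<close> to \<open>b\<close> meets the
    circle, where \<open>|P - P(a)|\<close> is at least \<open>\<epsilon>\<close>. For a centre
    within \<open>\<epsilon> / 3\<close> of \<open>P(a)\<close>, the shifted polynomial exceeds
    \<open>\<epsilon> / 2\<close> there but stays below \<open>\<epsilon> / 3\<close> at
    \<open>a\<close> and \<open>b\<close>.\<close>
  define \<epsilon> where "\<epsilon> = norm (poly P z0 - poly P a)"
  have \<epsilon>: "\<epsilon> > 0" using off[OF z0(1)] by (simp add: \<epsilon>_def)
  define K where "K = poly P ` {z. critical_point P z}"
  have "pderiv P \<noteq> 0" using deg by (simp add: pderiv_eq_0_iff)
  then have "finite K"
    unfolding K_def critical_point_def by (intro finite_imageI poly_roots_finite)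
  \<comment> \<open>The centres equidistant from two distinct critical values: finitely many
    bisectors, so they cannot fill a ball.\<close>
  define B where "B = (\<Union>u\<in>K. \<Union>v\<in>K - {u}. {x. dist x u = dist x v})"
  have "negligible B"
    unfolding B_def using \<open>finite K\<close> by (auto intro!: negligible_Union negligible_bisector)
  moreover have "\<not> negligible (ball (poly P a) (\<epsilon> / 3))"
    by (rule open_not_negligible) (use \<epsilon> in auto)
  ultimately have "\<not> ball (poly P a) (\<epsilon> / 3) \<subseteq> B" using negligible_subset by blast
  then obtain c where "c \<in> ball (poly P a) (\<epsilon> / 3)" "c \<notin> B" by blast
  then have c: "dist (poly P a) c < \<epsilon> / 3" "c \<notin> B" by simp_all
  define P' where "P' = P - [:c:]"
  have P': "poly P' z = poly P z - c" for z by (simp add: P'_def)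
  have crit: "critical_point P' = critical_point P"
    by (auto simp: critical_point_def P'_def pderiv_diff pderiv_pCons fun_eq_iff)
  have "infinite {z. \<exists>w. w \<noteq> z \<and> poly P' w = poly P' z \<and> poly Q w = poly Q z}"
  proof (rule infinite_coincidences_if_centered)
    show "degree P' > 0" using deg by (simp add: P'_def degree_diff_eq_left)
    have a: "norm (poly P' a) < \<epsilon> / 3" using c(1) by (simp add: P' dist_norm)
    then show "norm (poly P' a) < \<epsilon> / 2" "norm (poly P' b) < \<epsilon> / 2"
      using \<epsilon> ab by (simp_all add: P')
    show "\<not> connected_component (sublevel P' (\<epsilon> / 2)) a b"
    proof
      assume "connected_component (sublevel P' (\<epsilon> / 2)) a b"
      then obtain T where T: "connected T" "T \<subseteq> sublevel P' (\<epsilon> / 2)" "a \<in> T" "b \<in> T"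
        unfolding connected_component_def by blast
      have "a \<in> T \<inter> ball a \<delta>" "b \<in> T - ball a \<delta>" using T \<delta> by auto
      then obtain z where z: "z \<in> T" "z \<in> frontier (ball a \<delta>)"
        using connected_Int_frontier[OF T(1), of "ball a \<delta>"] by blast
      then have "\<epsilon> \<le> norm (poly P z - poly P a)" using z0(2) \<delta>(1) by (simp add: \<epsilon>_def)
      also have "\<dots> = norm (poly P' z - poly P' a)" by (simp add: P')
      also have "\<dots> \<le> norm (poly P' z) + norm (poly P' a)" by (rule norm_triangle_ineq4)
      also have "\<dots> < \<epsilon> / 2 + \<epsilon> / 3" using T(2) z(1) a by (intro add_strict_mono) auto
      finally show False using \<epsilon> by simp
    qed
    show "v = w" if "critical_point P' v" "critical_point P' w" "norm (poly P' v) = norm (poly P' w)"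
      "\<epsilon> / 2 \<le> norm (poly P' v)" for v w
    proof (rule uniq)
      show "critical_point P v" "critical_point P w" using that crit by simp_all
      then have K: "poly P v \<in> K" "poly P w \<in> K" by (auto simp: K_def)
      show "poly P v = poly P w"
      proof (rule ccontr)
        assume "poly P v \<noteq> poly P w"
        moreover have "dist c (poly P v) = dist c (poly P w)"
          using that(3) by (simp add: P' dist_norm norm_minus_commute)
        ultimately have "c \<in> B"
          unfolding B_def using K by (intro UN_I[of "poly P v"] UN_I[of "poly P w"]) simp_all
        then show False using c(2) by simp
      qed
      show "poly P v \<noteq> poly P a"
      proof
        assume "poly P v = poly P a"
        then have "norm (poly P' v) = norm (poly P' a)" by (simp add: P')
        then show False using that(4) a \<epsilon> by simp
      qed
    qed
    show "poly G a = poly G b" if "pderiv G = P' ^ k * pderiv Q" for k G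
    proof (rule mom)
      show "pderiv G = ([:- c, 1:] ^ k \<circ>\<^sub>p P) * pderiv Q"
        using that by (simp add: pcompose_power pcompose_linear P'_def)
    qed
  qed
  then show ?thesis by (simp add: P')
qed

section \<open>Induction on the degree and the equivalence\<close>

lemma composition_if_moments_vanish:
  fixes P Q :: "complex poly"
  assumes "poly P a = poly P b"
    and "\<And>v w. critical_point P v \<Longrightarrow> critical_point P w \<Longrightarrow> poly P v = poly P w \<Longrightarrow>
      poly P v \<noteq> poly P a \<Longrightarrow> v = w"
    and "\<And>R G. pderiv G = (R \<circ>\<^sub>p P) * pderiv Q \<Longrightarrow> poly G a = poly G b"
  shows "\<exists>P' Q' W. P = P' \<circ>\<^sub>p W \<and> Q = Q' \<circ>\<^sub>p W \<and> poly W a = poly W b"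
  using assms
proof (induction "degree P" arbitrary: P Q a b rule: less_induct)
  case less
  note ab = less.prems(1) and uniq = less.prems(2) and mom = less.prems(3)
  consider "degree P = 0" | "a = b" | "degree P > 0" "a \<noteq> b" by blast
  then show ?case
  proof cases
    case 1
    \<comment> \<open>For constant \<open>P\<close> take \<open>W = Q\<close>; the zeroth moment,
      with primitive \<open>Q\<close> itself, gives \<open>Q(a) = Q(b)\<close>.\<close>
    then obtain c where "P = [:c:]" by (metis degree_eq_zeroE)
    then have "P = [:c:] \<circ>\<^sub>p Q" by simp
    moreover have "Q = [:0, 1:] \<circ>\<^sub>p Q" by (simp add: pcompose_pCons)
    moreover have "poly Q a = poly Q b" using mom[of Q 1] by (simp add: pcompose_1)
    ultimately show ?thesis by blast
  next
    case 2
    have "P = P \<circ>\<^sub>p [:0, 1:]" "Q = Q \<circ>\<^sub>p [:0, 1:]" by simp_all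
    then show ?thesis using 2 by metis
  next
    case 3
    have "infinite {z. \<exists>w. w \<noteq> z \<and> poly P w = poly P z \<and> poly Q w = poly Q z}"
      by (rule infinite_coincidences[OF 3 ab]) (fact uniq mom)+
    then obtain P1 Q1 W where W: "P = P1 \<circ>\<^sub>p W" "Q = Q1 \<circ>\<^sub>p W" "degree W \<ge> 2"
      by (rule common_right_factor[OF 3(1)])
    have surj: "\<exists>z. poly W z = w" for w
    proof -
      have "\<not> constant (poly (W - [:w:]))"
        using W(3) by (subst constant_degree) (simp add: degree_diff_eq_left)
      then obtain z where "poly (W - [:w:]) z = 0" using fundamental_theorem_of_algebra by blast
      then show ?thesis by auto
    qed
    have crit: "critical_point P z" if "critical_point P1 (poly W z)" for z
      using that by (simp add: critical_point_def W(1) pderiv_pcompose poly_pcompose)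
    have "degree P1 < degree P"
      using 3(1) W(3) by (simp add: W(1) degree_pcompose)
    moreover have "poly P1 (poly W a) = poly P1 (poly W b)"
      using ab by (simp add: W(1) poly_pcompose)
    \<comment> \<open>Since \<open>W\<close> is surjective, critical points of \<open>P1\<close>
      lift to critical points of \<open>P\<close> with the same values; uniqueness identifies the
      lifts and hence their images.\<close>
    moreover have "v = w" if vw: "critical_point P1 v" "critical_point P1 w" "poly P1 v = poly P1 w"
      "poly P1 v \<noteq> poly P1 (poly W a)" for v w
    proof -
      obtain x y where xy: "poly W x = v" "poly W y = w" using surj by blast
      have "x = y"
      proof (rule uniq)
        show "critical_point P x" "critical_point P y" using vw(1,2) by (simp_all add: crit xy)
      qed (use vw(3,4) in \<open>simp_all add: xy W(1) poly_pcompose\<close>)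
      then show ?thesis using xy by simp
    qed
    moreover have "poly G (poly W a) = poly G (poly W b)" if "pderiv G = (R \<circ>\<^sub>p P1) * pderiv Q1" for R G
    proof -
      have "pderiv (G \<circ>\<^sub>p W) = (R \<circ>\<^sub>p P) * pderiv Q"
        by (simp add: pderiv_pcompose that W(1,2) pcompose_mult pcompose_assoc)
      from mom[OF this] show ?thesis by (simp add: poly_pcompose)
    qed
    ultimately obtain P' Q' V where V: "P1 = P' \<circ>\<^sub>p V" "Q1 = Q' \<circ>\<^sub>p V"
      "poly V (poly W a) = poly V (poly W b)"
      using less.hyps[of P1 "poly W a" "poly W b" Q1] by blast
    then have "P = P' \<circ>\<^sub>p (V \<circ>\<^sub>p W)" "Q = Q' \<circ>\<^sub>p (V \<circ>\<^sub>p W)"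
      "poly (V \<circ>\<^sub>p W) a = poly (V \<circ>\<^sub>p W) b"
      by (simp_all add: W(1,2) pcompose_assoc poly_pcompose)
    then show ?thesis by blast
  qed
qed

lemma has_contour_integral_linepath_pderiv:
  "((\<lambda>z. poly (pderiv G) z) has_contour_integral (poly G b - poly G a)) (linepath a b)"
  using contour_integral_primitive[of UNIV "poly G" "poly (pderiv G)" "linepath a b"]
  by (simp add: poly_DERIV)

theorem corollary3p2:
  fixes P q Q :: "complex poly" and a b c\<^sub>1 :: complex
  assumes "q \<noteq> 0"
    and "a \<noteq> b"
    and "pderiv Q = q"
    and "poly P a = c\<^sub>1" and "poly P b = c\<^sub>1"
    and "\<And>c. critical_value P c \<Longrightarrow> c \<noteq> c\<^sub>1 \<Longrightarrow>
           (\<exists>!z. z \<in> poly P -` {c} \<and> critical_point P z)"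
  shows "(\<forall>i::nat. contour_integral (linepath a b) (\<lambda>z. poly P z ^ i * poly q z) = 0) \<longleftrightarrow>
         (\<exists>P' Q' W :: complex poly.
            P = P' \<circ>\<^sub>p W \<and> Q = Q' \<circ>\<^sub>p W \<and> poly W a = poly W b)"
proof
  assume zero: "\<forall>i::nat. contour_integral (linepath a b) (\<lambda>z. poly P z ^ i * poly q z) = 0"
  have moment: "((\<lambda>z. poly P z ^ i * poly q z) has_contour_integral 0) (linepath a b)" for i
  proof -
    have "(\<lambda>z. poly P z ^ i * poly q z) contour_integrable_on linepath a b"
      by (intro contour_integrable_continuous_linepath continuous_intros)
    then show ?thesis using zero has_contour_integral_integral by metis
  qed
  show "\<exists>P' Q' W. P = P' \<circ>\<^sub>p W \<and> Q = Q' \<circ>\<^sub>p W \<and> poly W a = poly W b"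
  proof (rule composition_if_moments_vanish)
    show "poly P a = poly P b" using assms(4,5) by simp
    show "v = w" if "critical_point P v" "critical_point P w" "poly P v = poly P w" "poly P v \<noteq> poly P a" for v w
    proof -
      have "critical_value P (poly P v)" using that(1) by (auto simp: critical_value_def)
      then show ?thesis using assms(6)[of "poly P v"] that assms(4) by (auto simp: vimage_def)
    qed
    show "poly G a = poly G b" if G: "pderiv G = (R \<circ>\<^sub>p P) * pderiv Q" for R G
    proof -
      \<comment> \<open>Expanding \<open>R\<close> in powers makes the integral a linear combination
        of vanishing moments.\<close>
      have "((\<lambda>z. \<Sum>i\<le>degree R. coeff R i * (poly P z ^ i * poly q z)) has_contour_integral
          (\<Sum>i\<le>degree R. coeff R i * 0)) (linepath a b)"
        by (intro has_contour_integral_sum has_contour_integral_lmul moment finite_atMost)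
      moreover have "(\<lambda>z. \<Sum>i\<le>degree R. coeff R i * (poly P z ^ i * poly q z)) = poly (pderiv G)"
        by (simp add: G assms(3) fun_eq_iff poly_pcompose poly_altdef[of R] sum_distrib_right mult.assoc)
      ultimately have "(poly (pderiv G) has_contour_integral 0) (linepath a b)" by simp
      then show ?thesis
        using has_contour_integral_linepath_pderiv has_contour_integral_unique by fastforce
    qed
  qed
next
  assume "\<exists>P' Q' W. P = P' \<circ>\<^sub>p W \<and> Q = Q' \<circ>\<^sub>p W \<and> poly W a = poly W b"
  then obtain P' Q' W where W: "P = P' \<circ>\<^sub>p W" "Q = Q' \<circ>\<^sub>p W" "poly W a = poly W b" by blast
  show "\<forall>i::nat. contour_integral (linepath a b) (\<lambda>z. poly P z ^ i * poly q z) = 0"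
  proof
    fix i
    \<comment> \<open>A primitive in the variable \<open>W\<close>: its composite with
      \<open>W\<close> is a primitive of the integrand and takes equal values at \<open>a\<close>
      and \<open>b\<close>.\<close>
    obtain G where G: "pderiv G = P' ^ i * pderiv Q'" using pderiv_surj by blast
    have "poly (pderiv (G \<circ>\<^sub>p W)) z = poly P z ^ i * poly q z" for z
      by (simp add: pderiv_pcompose G W(1,2) poly_pcompose flip: assms(3))
    then have "((\<lambda>z. poly P z ^ i * poly q z) has_contour_integral 0) (linepath a b)"
      using has_contour_integral_linepath_pderiv[of "G \<circ>\<^sub>p W" b a] W(3) by (simp add: poly_pcompose)
    then show "contour_integral (linepath a b) (\<lambda>z. poly P z ^ i * poly q z) = 0"
      by (rule contour_integral_unique)
  qed
qed

end
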